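(* Let $(X,\mathcal{B},\mu,f)$ be a dissipative measurable system of bounded distortion, let $p\ge 1$ be a real number, assume $L^p(X)$ is separable, and let $T_f:L^p(X)\to L^p(X)$, $T_f\varphi=\varphi\circ f$, be the associated composition operator. Then the following statements are equivalent: (a) $f$ satisfies the Summability Condition (SC); (b) $T_f$ is frequently hypercyclic; (c) $T_f$ is chaotic.
   Context: A measurable system is a tuple $(X,\mathcal{B},\mu,f)$ where: $(X,\mathcal{B},\mu)$ is a $\sigma$-finite measure space with $\mu(X)>0$; $f:X\to X$ is bijective, bimeasurable ($f(B),f^{-1}(B)\in\mathcal{B}$ for all $B\in\mathcal{B}$) and nonsingular ($\mu(f^{-1}(B))=0$ if and only if $\mu(B)=0$); and there is $c>0$ with $\mu(f^{-1}(B))\le c\,\mu(B)$ for all $B\in\mathcal{B}$. The last condition makes $T_f$ a continuous linear operator on $L^p(X)$. The system is dissipative if there is $W\in\mathcal{B}$ such that the sets $f^n(W)$, $n\in\mathbb{Z}$, are pairwise disjoint and $X=\bigcup_{n\in\mathbb{Z}}f^n(W)$. A measurable set $W$ is wandering if the sets $f^n(W)$, $n\in\mathbb{Z}$, are pairwise disjoint. A dissipative system is of bounded distortion if there exist a wandering set $W$ with $0<\mu(W)<\infty$ and $K>0$ such that (i) $X=\bigcup_{n\in\mathbb{Z}}f^n(W)$; (ii) for all $n\in\mathbb{Z}$ and all measurable $C\subseteq W$ with $\mu(C)>0$, $$\frac1K\,\frac{\mu(f^n(W))}{\mu(W)}\le\frac{\mu(f^n(C))}{\mu(C)}\le K\,\frac{\mu(f^n(W))}{\mu(W)}.$$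 Summability Condition (SC): for each $\epsilon>0$ and each $B\in\mathcal{B}$ with $\mu(B)<\infty$ there is a measurable $B'\subseteq B$ with $\mu(B\setminus B')<\epsilon$ and $\sum_{n\in\mathbb{Z}}\mu(f^n(B'))<\infty$. Let $T$ be a continuous linear operator on a separable Banach space $\mathcal{H}$. $T$ is topologically transitive if for all non-empty open $U,V\subseteq\mathcal{H}$ there is $k>0$ with $T^k(U)\cap V\ne\emptyset$; $T$ is chaotic if it is topologically transitive and its periodic points are dense in $\mathcal{H}$; $T$ is frequently hypercyclic if there is $\varphi\in\mathcal{H}$ such that for every non-empty open $U\subseteq\mathcal{H}$, $\liminf_{N\to\infty}\frac1N\#\{1\le n\le N: T^n\varphi\in U\}>0$. *)

theory Defs
  imports "HOL-Analysis.Analysis"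
begin

section \<open>Measurable systems\<close>

definition int_iterate :: "'a set \<Rightarrow> ('a \<Rightarrow> 'a) \<Rightarrow> int \<Rightarrow> 'a \<Rightarrow> 'a" where
  "int_iterate X f n = (if 0 \<le> n then f ^^ nat n else inv_into X f ^^ nat (- n))"

locale measurable_system = sigma_finite_measure M for M :: "'a measure" +
  fixes f :: "'a \<Rightarrow> 'a"
  assumes nontrivial: "0 < emeasure M (space M)"
    and bij: "bij_betw f (space M) (space M)"
    and image_sets: "\<And>B. B \<in> sets M \<Longrightarrow> f ` B \<in> sets M"
    and vimage_sets: "\<And>B. B \<in> sets M \<Longrightarrow> f -` B \<inter> space M \<in> sets M"
    and nonsingular:
      "\<And>B. B \<in> sets M \<Longrightarrow> emeasure M (f -` B \<inter> space M) = 0 \<longleftrightarrow> emeasure M B = 0"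
    and bounded:
      "\<exists>c>0. \<forall>B\<in>sets M. emeasure M (f -` B \<inter> space M) \<le> ennreal c * emeasure M B"

definition wandering :: "'a measure \<Rightarrow> ('a \<Rightarrow> 'a) \<Rightarrow> 'a set \<Rightarrow> bool" where
  "wandering M f W \<longleftrightarrow>
     W \<in> sets M \<and> disjoint_family (\<lambda>n. int_iterate (space M) f n ` W)"

locale dissipative_system = measurable_system +
  assumes dissipative:
    "\<exists>W. wandering M f W \<and> space M = (\<Union>n. int_iterate (space M) f n ` W)"

text \<open>The quotients below are taken in \<^typ>\<open>ennreal\<close>; their denominators are positive and
  finite because \<open>0 < \<mu>(C) \<le> \<mu>(W) < \<infinity>\<close>.\<close>

locale bounded_distortion_system = dissipative_system +
  assumes bounded_distortion:
    "\<exists>W (K::real). wandering M f W \<and> 0 < emeasure M W \<and> emeasure M W < \<infinity> \<and> 0 < K \<and>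
       space M = (\<Union>n. int_iterate (space M) f n ` W) \<and>
       (\<forall>n. \<forall>C\<in>sets M. C \<subseteq> W \<and> 0 < emeasure M C \<longrightarrow>
          ennreal (1 / K) * (emeasure M (int_iterate (space M) f n ` W) / emeasure M W)
            \<le> emeasure M (int_iterate (space M) f n ` C) / emeasure M C \<and>
          emeasure M (int_iterate (space M) f n ` C) / emeasure M C
            \<le> ennreal K * (emeasure M (int_iterate (space M) f n ` W) / emeasure M W))"

definition summability_condition :: "'a measure \<Rightarrow> ('a \<Rightarrow> 'a) \<Rightarrow> bool" where
  "summability_condition M f \<longleftrightarrow>
     (\<forall>\<epsilon>::real. \<forall>B\<in>sets M. 0 < \<epsilon> \<and> emeasure M B < \<infinity> \<longrightarrow>
        (\<exists>B'\<in>sets M. B' \<subseteq> B \<and> emeasure M (B - B') < ennreal \<epsilon> \<and>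
           (\<Sum>\<^sub>\<infinity>n\<in>UNIV. emeasure M (int_iterate (space M) f n ` B')) < \<infinity>))"


section \<open>Linear dynamics\<close>

text \<open>The notions depend only on the norm topology of the Banach space and on the operator as a
  map on its underlying set, so they are stated for a self-map of an abstract topology. This
  allows the space \<open>L\<^sup>p\<close> below, which depends on a measure and hence is not a type.\<close>

definition topologically_transitive :: "'b topology \<Rightarrow> ('b \<Rightarrow> 'b) \<Rightarrow> bool" where
  "topologically_transitive X T \<longleftrightarrow>
     (\<forall>U V. openin X U \<and> openin X V \<and> U \<noteq> {} \<and> V \<noteq> {} \<longrightarrow>
        (\<exists>k>0. (T ^^ k) ` U \<inter> V \<noteq> {}))"

definition periodic_points :: "'b topology \<Rightarrow> ('b \<Rightarrow> 'b) \<Rightarrow> 'b set" where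
  "periodic_points X T = {\<phi> \<in> topspace X. \<exists>k>0. (T ^^ k) \<phi> = \<phi>}"

definition chaotic :: "'b topology \<Rightarrow> ('b \<Rightarrow> 'b) \<Rightarrow> bool" where
  "chaotic X T \<longleftrightarrow>
     topologically_transitive X T \<and> X closure_of periodic_points X T = topspace X"

definition frequently_hypercyclic :: "'b topology \<Rightarrow> ('b \<Rightarrow> 'b) \<Rightarrow> bool" where
  "frequently_hypercyclic X T \<longleftrightarrow>
     (\<exists>\<phi>\<in>topspace X. \<forall>U. openin X U \<and> U \<noteq> {} \<longrightarrow>
        0 < liminf (\<lambda>N. ereal (real (card {n \<in> {1..N}. (T ^^ n) \<phi> \<in> U}) / real N)))"


section \<open>The spaces \<open>L\<^sup>p\<close> and the composition operator\<close>

text \<open>The scalar type ranges over \<open>{real_normed_field, euclidean_space}\<close>, whose members are,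
  up to isomorphism, exactly the fields of real and of complex numbers. Elements of \<open>L\<^sup>p\<close> are
  classes of functions modulo equality almost everywhere; values outside
  \<open>space M\<close> are irrelevant.\<close>

definition Lp_fun :: "'a measure \<Rightarrow> real \<Rightarrow> ('a \<Rightarrow> 'k::{real_normed_field, euclidean_space}) set"
  where "Lp_fun M p = {u \<in> borel_measurable M. integrable M (\<lambda>x. norm (u x) powr p)}"

definition Lp_norm :: "'a measure \<Rightarrow> real \<Rightarrow> ('a \<Rightarrow> 'k::{real_normed_field, euclidean_space}) \<Rightarrow> real"
  where "Lp_norm M p u = (LINT x|M. norm (u x) powr p) powr (1 / p)"

definition Lp_class ::
  "'a measure \<Rightarrow> real \<Rightarrow> ('a \<Rightarrow> 'k::{real_normed_field, euclidean_space}) \<Rightarrow> ('a \<Rightarrow> 'k) set"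
  where "Lp_class M p u = {v \<in> Lp_fun M p. AE x in M. v x = u x}"

definition Lp_space ::
  "'a measure \<Rightarrow> real \<Rightarrow> ('a \<Rightarrow> 'k::{real_normed_field, euclidean_space}) set set"
  where "Lp_space M p = Lp_class M p ` Lp_fun M p"

definition Lp_rep :: "('a \<Rightarrow> 'k::{real_normed_field, euclidean_space}) set \<Rightarrow> 'a \<Rightarrow> 'k"
  where "Lp_rep A = (SOME u. u \<in> A)"

definition Lp_dist ::
  "'a measure \<Rightarrow> real \<Rightarrow> ('a \<Rightarrow> 'k::{real_normed_field, euclidean_space}) set \<Rightarrow> ('a \<Rightarrow> 'k) set \<Rightarrow> real"
  where "Lp_dist M p A B = Lp_norm M p (\<lambda>x. Lp_rep A x - Lp_rep B x)"

definition Lp_topology ::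
  "'a measure \<Rightarrow> real \<Rightarrow> ('a \<Rightarrow> 'k::{real_normed_field, euclidean_space}) set topology"
  where "Lp_topology M p = Metric_space.mtopology (Lp_space M p) (Lp_dist M p)"

definition composition_operator ::
  "'a measure \<Rightarrow> real \<Rightarrow> ('a \<Rightarrow> 'a) \<Rightarrow>
     ('a \<Rightarrow> 'k::{real_normed_field, euclidean_space}) set \<Rightarrow> ('a \<Rightarrow> 'k) set"
  where "composition_operator M p f A = Lp_class M p (Lp_rep A \<circ> f)"


subsection \<open>Well-definedness\<close>

lemma powr_convex_nonneg:
  fixes p l x y :: real
  assumes p: "1 \<le> p" and l: "0 \<le> l" "l \<le> 1" and xy: "0 \<le> x" "0 \<le> y"
  shows "(l * x + (1 - l) * y) powr p \<le> l * x powr p + (1 - l) * y powr p"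
proof -
  have aux: "(m * z) powr p \<le> m * z powr p" if "0 \<le> m" "m \<le> 1" "0 \<le> z" for m z :: real
  proof (cases "m = 0")
    case False
    then have "m powr p \<le> m powr 1"
      using that p by (intro powr_mono') auto
    then show ?thesis
      using that False by (simp add: powr_mult mult_right_mono)
  qed simp
  show ?thesis
  proof (cases "x = 0 \<or> y = 0")
    case True
    then show ?thesis
      using aux[of l x] aux[of "1 - l" y] assms by auto
  next
    case False
    then show ?thesis
      using convex_onD[OF powr_convex[OF p], of l y x] l xy by (simp add: algebra_simps)
  qed
qed

lemma powr_add_weighted:
  fixes p a b s t :: real
  assumes p: "1 \<le> p" and ab: "0 < a" "0 < b" and st: "0 \<le> s" "0 \<le> t"
  shows "(s + t) powr p \<le> (a + b) powr p *
    (a / (a + b) * (s powr p / a powr p) + b / (a + b) * (t powr p / b powr p))"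
proof -
  have 1: "1 - a / (a + b) = b / (a + b)"
    using ab by (simp add: field_simps)
  have "(a / (a + b) * (s / a) + (1 - a / (a + b)) * (t / b)) powr p
      \<le> a / (a + b) * (s / a) powr p + (1 - a / (a + b)) * (t / b) powr p"
    using ab st by (intro powr_convex_nonneg[OF p]) auto
  moreover have "a / (a + b) * (s / a) + b / (a + b) * (t / b) = (s + t) / (a + b)"
    using ab by (simp add: add_divide_distrib)
  ultimately have "((s + t) / (a + b)) powr p
      \<le> a / (a + b) * (s powr p / a powr p) + b / (a + b) * (t powr p / b powr p)"
    using ab st by (simp add: 1 powr_divide)
  then have "(a + b) powr p * ((s + t) powr p / (a + b) powr p) \<le> (a + b) powr p *
    (a / (a + b) * (s powr p / a powr p) + b / (a + b) * (t powr p / b powr p))"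
    using ab st by (intro mult_left_mono) (auto simp: powr_divide)
  then show ?thesis
    using ab by simp
qed

lemma Lp_norm_nonneg [simp]: "0 \<le> Lp_norm M p u"
  by (simp add: Lp_norm_def)

lemma Lp_norm_powr:
  assumes "1 \<le> p"
  shows "Lp_norm M p u powr p = (LINT x|M. norm (u x) powr p)"
  using assms by (simp add: Lp_norm_def powr_powr)

lemma Lp_norm_cong_AE:
  assumes "u \<in> borel_measurable M" "v \<in> borel_measurable M" "AE x in M. u x = v x"
  shows "Lp_norm M p u = Lp_norm M p v"
proof -
  have "(LINT x|M. norm (u x) powr p) = (LINT x|M. norm (v x) powr p)"
    using assms by (intro integral_cong_AE) auto
  then show ?thesis by (simp add: Lp_norm_def)
qed

lemma Lp_norm_minus_commute: "Lp_norm M p (\<lambda>x. u x - v x) = Lp_norm M p (\<lambda>x. v x - u x)"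
  by (simp add: Lp_norm_def norm_minus_commute)

lemma Lp_norm_eq_0_iff:
  assumes "1 \<le> p" "u \<in> Lp_fun M p"
  shows "Lp_norm M p u = 0 \<longleftrightarrow> (AE x in M. u x = 0)"
proof -
  have "(LINT x|M. norm (u x) powr p) = 0 \<longleftrightarrow> (AE x in M. norm (u x) powr p = 0)"
    using assms by (intro integral_nonneg_eq_0_iff_AE) (auto simp: Lp_fun_def)
  then show ?thesis using assms by (simp add: Lp_norm_def)
qed

lemma Lp_fun_add:
  assumes p: "1 \<le> p" and u: "u \<in> Lp_fun M p" and v: "v \<in> Lp_fun M p"
  shows "(\<lambda>x. u x + v x) \<in> Lp_fun M p"
proof -
  have "integrable M (\<lambda>x. norm (u x + v x) powr p)"
  proof (rule Bochner_Integration.integrable_bound)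
    show "integrable M (\<lambda>x. 2 powr p * (1/2 * norm (u x) powr p + 1/2 * norm (v x) powr p))"
      using u v by (auto simp: Lp_fun_def)
    show "(\<lambda>x. norm (u x + v x) powr p) \<in> borel_measurable M"
      using u v by (auto simp: Lp_fun_def)
    show "AE x in M. norm (norm (u x + v x) powr p)
        \<le> norm (2 powr p * (1/2 * norm (u x) powr p + 1/2 * norm (v x) powr p))"
    proof (rule AE_I2)
      fix x
      have "norm (u x + v x) powr p \<le> (norm (u x) + norm (v x)) powr p"
        using p by (intro powr_mono2) (auto intro: norm_triangle_ineq)
      also have "\<dots> \<le> 2 powr p * (1/2 * norm (u x) powr p + 1/2 * norm (v x) powr p)"
        using powr_add_weighted[OF p, of 1 1 "norm (u x)" "norm (v x)"] by simp
      finally show "norm (norm (u x + v x) powr p)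
        \<le> norm (2 powr p * (1/2 * norm (u x) powr p + 1/2 * norm (v x) powr p))"
        by simp
    qed
  qed
  then show ?thesis using u v by (auto simp: Lp_fun_def)
qed

lemma Lp_fun_diff:
  assumes "1 \<le> p" and "u \<in> Lp_fun M p" and v: "v \<in> Lp_fun M p"
  shows "(\<lambda>x. u x - v x) \<in> Lp_fun M p"
proof -
  have "(\<lambda>x. - v x) \<in> Lp_fun M p" using v by (auto simp: Lp_fun_def)
  from Lp_fun_add[OF assms(1,2) this] show ?thesis by simp
qed

lemma Minkowski_inequality:
  assumes p: "1 \<le> p" and u: "u \<in> Lp_fun M p" and v: "v \<in> Lp_fun M p"
  shows "Lp_norm M p (\<lambda>x. u x + v x) \<le> Lp_norm M p u + Lp_norm M p v"
proof -
  define a where "a = Lp_norm M p u"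
  define b where "b = Lp_norm M p v"
  have meas: "u \<in> borel_measurable M" "v \<in> borel_measurable M"
    using u v by (auto simp: Lp_fun_def)
  consider "a = 0" | "b = 0" | "0 < a" "0 < b"
    using Lp_norm_nonneg[of M p u] Lp_norm_nonneg[of M p v] unfolding a_def b_def by linarith
  then show ?thesis
  proof cases
    case 1
    then have "AE x in M. u x = 0" using Lp_norm_eq_0_iff[OF p u] a_def by simp
    then have "AE x in M. u x + v x = v x" by eventually_elim simp
    then have "Lp_norm M p (\<lambda>x. u x + v x) = Lp_norm M p v"
      using meas by (intro Lp_norm_cong_AE) auto
    then show ?thesis by simp
  next
    case 2
    then have "AE x in M. v x = 0" using Lp_norm_eq_0_iff[OF p v] b_def by simp
    then have "AE x in M. u x + v x = u x" by eventually_elim simp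
    then have "Lp_norm M p (\<lambda>x. u x + v x) = Lp_norm M p u"
      using meas by (intro Lp_norm_cong_AE) auto
    then show ?thesis by simp
  next
    case 3
    define U where "U = (\<lambda>x. norm (u x) powr p)"
    define V where "V = (\<lambda>x. norm (v x) powr p)"
    have int: "integrable M U" "integrable M V"
      using u v by (auto simp: Lp_fun_def U_def V_def)
    have UV: "integral\<^sup>L M U = a powr p" "integral\<^sup>L M V = b powr p"
      by (simp_all add: U_def V_def a_def b_def Lp_norm_powr[OF p])
    have "Lp_norm M p (\<lambda>x. u x + v x) powr p = (LINT x|M. norm (u x + v x) powr p)"
      by (rule Lp_norm_powr[OF p])
    also have "\<dots> \<le> (LINT x|M. (a + b) powr p *
        (a / (a + b) * (U x / a powr p) + b / (a + b) * (V x / b powr p)))"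
    proof (rule integral_mono)
      show "integrable M (\<lambda>x. norm (u x + v x) powr p)"
        using Lp_fun_add[OF p u v] by (simp add: Lp_fun_def)
      show "integrable M (\<lambda>x. (a + b) powr p *
        (a / (a + b) * (U x / a powr p) + b / (a + b) * (V x / b powr p)))"
        using int by auto
      fix x
      have "norm (u x + v x) powr p \<le> (norm (u x) + norm (v x)) powr p"
        using p by (intro powr_mono2) (auto intro: norm_triangle_ineq)
      also have "\<dots> \<le> (a + b) powr p *
        (a / (a + b) * (U x / a powr p) + b / (a + b) * (V x / b powr p))"
        unfolding U_def V_def using 3 by (intro powr_add_weighted[OF p]) auto
      finally show "norm (u x + v x) powr p \<le> (a + b) powr p *
        (a / (a + b) * (U x / a powr p) + b / (a + b) * (V x / b powr p))" .
    qed
    also have "\<dots> = (a + b) powr p *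
        (a / (a + b) * (integral\<^sup>L M U / a powr p) + b / (a + b) * (integral\<^sup>L M V / b powr p))"
      using int by simp
    also have "\<dots> = (a + b) powr p * (a / (a + b) + b / (a + b))"
      using 3 by (simp add: UV)
    also have "\<dots> = (a + b) powr p"
      using 3 by (simp add: add_divide_distrib[symmetric])
    finally have le: "Lp_norm M p (\<lambda>x. u x + v x) powr p \<le> (a + b) powr p" .
    have "Lp_norm M p (\<lambda>x. u x + v x) \<le> a + b"
    proof (rule ccontr)
      assume "\<not> ?thesis"
      then have "(a + b) powr p < Lp_norm M p (\<lambda>x. u x + v x) powr p"
        using p 3 by (intro powr_less_mono2) auto
      then show False using le by simp
    qed
    then show ?thesis by (simp add: a_def b_def)
  qed
qed

lemma Lp_rep_in:
  assumes "A \<in> Lp_space M p"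
  shows "Lp_rep A \<in> Lp_fun M p" "Lp_class M p (Lp_rep A) = A"
proof -
  obtain u where u: "u \<in> Lp_fun M p" "A = Lp_class M p u"
    using assms by (auto simp: Lp_space_def)
  then have "u \<in> A" by (simp add: Lp_class_def)
  then have rep: "Lp_rep A \<in> A" unfolding Lp_rep_def by (metis someI)
  then show "Lp_rep A \<in> Lp_fun M p" by (simp add: u Lp_class_def)
  have "AE x in M. Lp_rep A x = u x" using rep by (simp add: u Lp_class_def)
  then have "(AE x in M. v x = Lp_rep A x) \<longleftrightarrow> (AE x in M. v x = u x)" for v
    by (intro iffI; (elim AE_mp; auto)?)
  then show "Lp_class M p (Lp_rep A) = A"
    by (simp add: u(2) Lp_class_def)
qed

lemma Lp_class_in_space: "u \<in> Lp_fun M p \<Longrightarrow> Lp_class M p u \<in> Lp_space M p"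
  by (simp add: Lp_space_def)

lemma Lp_class_eq_iff:
  assumes "u \<in> Lp_fun M p"
  shows "Lp_class M p u = Lp_class M p v \<longleftrightarrow> (AE x in M. u x = v x)"
proof
  assume "Lp_class M p u = Lp_class M p v"
  moreover have "u \<in> Lp_class M p u" using assms by (simp add: Lp_class_def)
  ultimately show "AE x in M. u x = v x" by (auto simp: Lp_class_def)
next
  assume *: "AE x in M. u x = v x"
  have "(AE x in M. w x = u x) \<longleftrightarrow> (AE x in M. w x = v x)" for w
    using * by (intro iffI; (elim AE_mp; auto)?)
  then show "Lp_class M p u = Lp_class M p v" by (simp add: Lp_class_def)
qed

lemma Lp_rep_class_AE:
  assumes "u \<in> Lp_fun M p"
  shows "AE x in M. Lp_rep (Lp_class M p u) x = u x"
  using Lp_rep_in[OF Lp_class_in_space[OF assms]] Lp_class_eq_iff by blast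

lemma Lp_dist_class:
  assumes "u \<in> Lp_fun M p" "v \<in> Lp_fun M p"
  shows "Lp_dist M p (Lp_class M p u) (Lp_class M p v) = Lp_norm M p (\<lambda>x. u x - v x)"
  unfolding Lp_dist_def
proof (rule Lp_norm_cong_AE)
  show "AE x in M. Lp_rep (Lp_class M p u) x - Lp_rep (Lp_class M p v) x = u x - v x"
    using Lp_rep_class_AE[OF assms(1)] Lp_rep_class_AE[OF assms(2)] by eventually_elim simp
qed (use assms Lp_rep_in(1)[OF Lp_class_in_space[OF assms(1)]]
    Lp_rep_in(1)[OF Lp_class_in_space[OF assms(2)]] in \<open>auto simp: Lp_fun_def\<close>)

lemma Metric_space_Lp:
  assumes p: "1 \<le> p"
  shows "Metric_space (Lp_space M p) (Lp_dist M p)"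
proof
  fix A B C :: "('a \<Rightarrow> 'b) set"
  show "0 \<le> Lp_dist M p A B" by (simp add: Lp_dist_def)
  show "Lp_dist M p A B = Lp_dist M p B A"
    unfolding Lp_dist_def by (rule Lp_norm_minus_commute)
  assume A: "A \<in> Lp_space M p" and B: "B \<in> Lp_space M p"
  note rA = Lp_rep_in[OF A] and rB = Lp_rep_in[OF B]
  have "Lp_dist M p A B = 0 \<longleftrightarrow> (AE x in M. Lp_rep A x - Lp_rep B x = 0)"
    unfolding Lp_dist_def by (intro Lp_norm_eq_0_iff[OF p] Lp_fun_diff[OF p] rA rB)
  also have "\<dots> \<longleftrightarrow> A = B"
    using Lp_class_eq_iff[OF rA(1), of "Lp_rep B"] rA rB by simp
  finally show "Lp_dist M p A B = 0 \<longleftrightarrow> A = B" .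
  assume C: "C \<in> Lp_space M p"
  note rC = Lp_rep_in[OF C]
  show "Lp_dist M p A C \<le> Lp_dist M p A B + Lp_dist M p B C"
    using Minkowski_inequality[OF p Lp_fun_diff[OF p rA(1) rB(1)] Lp_fun_diff[OF p rB(1) rC(1)]]
    by (simp add: Lp_dist_def)
qed

lemma topspace_Lp [simp]: "1 \<le> p \<Longrightarrow> topspace (Lp_topology M p) = Lp_space M p"
  by (simp add: Lp_topology_def Metric_space.topspace_mtopology[OF Metric_space_Lp])

context measurable_system
begin

lemma measurable_f: "f \<in> measurable M M"
  using bij vimage_sets by (auto intro!: measurableI simp: bij_betw_def)

lemma AE_compose:
  assumes "AE x in M. P x"
  shows "AE x in M. P (f x)"
proof -
  obtain N where N: "{x \<in> space M. \<not> P x} \<subseteq> N" "emeasure M N = 0" "N \<in> sets M"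
    using assms by (rule AE_E)
  have "emeasure M (f -` N \<inter> space M) = 0" using N nonsingular by simp
  moreover have "{x \<in> space M. \<not> P (f x)} \<subseteq> f -` N \<inter> space M"
    using N(1) measurable_space[OF measurable_f] by auto
  ultimately show ?thesis using N(3) vimage_sets by (intro AE_I)
qed

lemma Lp_compose:
  obtains c where "0 < c"
    "\<And>p (u :: 'a \<Rightarrow> 'k::{real_normed_field, euclidean_space}).
       \<lbrakk>1 \<le> p; u \<in> Lp_fun M p\<rbrakk> \<Longrightarrow>
         u \<circ> f \<in> Lp_fun M p \<and> Lp_norm M p (u \<circ> f) \<le> c powr (1 / p) * Lp_norm M p u"
proof -
  obtain c where c: "0 < c"
    "\<forall>B\<in>sets M. emeasure M (f -` B \<inter> space M) \<le> ennreal c * emeasure M B"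
    using bounded by blast
  have le: "distr M M f \<le> scale_measure (ennreal c) M"
    using c by (subst le_measure) (auto simp: emeasure_distr[OF measurable_f] sets_scale_measure)
  show thesis
  proof (rule that[OF c(1)])
    fix p :: real and u :: "'a \<Rightarrow> 'k"
    assume p: "1 \<le> p" and u: "u \<in> Lp_fun M p"
    have um: "u \<in> borel_measurable M" and ui: "integrable M (\<lambda>x. norm (u x) powr p)"
      using u by (auto simp: Lp_fun_def)
    have m: "u \<circ> f \<in> borel_measurable M"
      using measurable_comp[OF measurable_f um] .
    have "(\<integral>\<^sup>+x. ennreal (norm (u (f x)) powr p) \<partial>M)
        = (\<integral>\<^sup>+x. ennreal (norm (u x) powr p) \<partial>distr M M f)"
      using um by (subst nn_integral_distr[OF measurable_f]) auto
    also have "\<dots> \<le> (\<integral>\<^sup>+x. ennreal (norm (u x) powr p) \<partial>scale_measure (ennreal c) M)"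
      by (rule nn_integral_mono_measure) (use le in \<open>auto simp: sets_scale_measure\<close>)
    also have "\<dots> = ennreal c * (\<integral>\<^sup>+x. ennreal (norm (u x) powr p) \<partial>M)"
      using um by (intro nn_integral_scale_measure) auto
    also have "\<dots> = ennreal c * ennreal (LINT x|M. norm (u x) powr p)"
      using ui by (subst nn_integral_eq_integral) auto
    finally have le2: "(\<integral>\<^sup>+x. ennreal (norm (u (f x)) powr p) \<partial>M)
        \<le> ennreal (c * (LINT x|M. norm (u x) powr p))"
      using c(1) by (simp add: ennreal_mult')
    have int: "integrable M (\<lambda>x. norm (u (f x)) powr p)"
      using m le2 by (intro integrableI_bounded) (auto simp: o_def intro: le_less_trans)
    then have "ennreal (LINT x|M. norm (u (f x)) powr p)
        \<le> ennreal (c * (LINT x|M. norm (u x) powr p))"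
      using le2 by (subst (asm) nn_integral_eq_integral) auto
    then have "(LINT x|M. norm (u (f x)) powr p) \<le> c * (LINT x|M. norm (u x) powr p)"
      using c(1) by (simp add: ennreal_le_iff)
    then have "(LINT x|M. norm (u (f x)) powr p) powr (1 / p)
        \<le> (c * (LINT x|M. norm (u x) powr p)) powr (1 / p)"
      using p by (intro powr_mono2) auto
    then show "u \<circ> f \<in> Lp_fun M p \<and> Lp_norm M p (u \<circ> f) \<le> c powr (1 / p) * Lp_norm M p u"
      using m int c(1) by (simp add: Lp_fun_def Lp_norm_def o_def powr_mult)
  qed
qed

lemma composition_operator_class:
  assumes p: "1 \<le> p" and u: "u \<in> Lp_fun M p"
  shows "composition_operator M p f (Lp_class M p u) = Lp_class M p (u \<circ> f)"
proof -
  have *: "Lp_rep (Lp_class M p u) \<in> Lp_fun M p"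
    by (rule Lp_rep_in(1)[OF Lp_class_in_space[OF u]])
  then have "Lp_rep (Lp_class M p u) \<circ> f \<in> Lp_fun M p"
    using Lp_compose p by metis
  then show ?thesis
    unfolding composition_operator_def
    using AE_compose[OF Lp_rep_class_AE[OF u]] by (subst Lp_class_eq_iff) auto
qed

lemma continuous_composition_operator:
  assumes p: "1 \<le> p"
  shows "continuous_map (Lp_topology M p)
    (Lp_topology M p :: ('a \<Rightarrow> 'k::{real_normed_field, euclidean_space}) set topology)
    (composition_operator M p f)"
proof -
  interpret L: Metric_space "Lp_space M p :: ('a \<Rightarrow> 'k) set set" "Lp_dist M p"
    by (rule Metric_space_Lp[OF p])
  obtain c where c: "0 < c" "\<And>u :: 'a \<Rightarrow> 'k. u \<in> Lp_fun M p \<Longrightarrow>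
      u \<circ> f \<in> Lp_fun M p \<and> Lp_norm M p (u \<circ> f) \<le> c powr (1 / p) * Lp_norm M p u"
    using Lp_compose p by metis
  have "Lipschitz_continuous_map (metric (Lp_space M p :: ('a \<Rightarrow> 'k) set set, Lp_dist M p))
      (metric (Lp_space M p, Lp_dist M p)) (composition_operator M p f)"
    unfolding Lipschitz_continuous_map_def
  proof (intro conjI exI ballI funcsetI)
    fix A assume "A \<in> mspace (metric (Lp_space M p :: ('a \<Rightarrow> 'k) set set, Lp_dist M p))"
    then have A: "A \<in> Lp_space M p" by simp
    then show "composition_operator M p f A \<in> mspace (metric (Lp_space M p, Lp_dist M p))"
      using c(2)[OF Lp_rep_in(1)[OF A]]
      by (simp add: composition_operator_def Lp_class_in_space)
    fix B assume "B \<in> mspace (metric (Lp_space M p :: ('a \<Rightarrow> 'k) set set, Lp_dist M p))"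
    then have B: "B \<in> Lp_space M p" by simp
    note r = Lp_rep_in(1)[OF A] Lp_rep_in(1)[OF B]
    show "mdist (metric (Lp_space M p, Lp_dist M p))
        (composition_operator M p f A) (composition_operator M p f B)
      \<le> c powr (1 / p) * mdist (metric (Lp_space M p, Lp_dist M p)) A B"
      using c(2)[OF Lp_fun_diff[OF p r]] c(2)[OF r(1)] c(2)[OF r(2)]
      by (simp add: composition_operator_def Lp_dist_class) (simp add: Lp_dist_def o_def)
  qed
  then have "continuous_map (mtopology_of (metric (Lp_space M p :: ('a \<Rightarrow> 'k) set set, Lp_dist M p)))
      (mtopology_of (metric (Lp_space M p, Lp_dist M p))) (composition_operator M p f)"
    by (rule Lipschitz_continuous_imp_continuous_map)
  then show ?thesis
    by (simp add: Lp_topology_def mtopology_of_def)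
qed

end

end

(* All three conditions are equivalent to mu(X) < oo. Bounded distortion makes mu(f^n C) comparable to
  mu(f^n W) for every C inside W, which gives this for (SC).

  If a function has iterates close to the indicator of W at all times of a set E of positive lower
  density (a frequently hypercyclic vector, or a periodic point close to the indicator), then the
  measures mu(f^k W) have bounded sums over the differences k of elements of E. The differences that
  occur with positive frequency form a syndetic set, and mu(f^k W) <= c mu(f^(k+1) W) extends
  summability from there to all k.

  If mu(X) < oo, then a bounded function supported on finitely many levels f^k W is close to its
  periodic extension along the levels. For frequent hypercyclicity, copies of a dense sequence of such
  functions are placed around the points of mutually distant sets of positive lower density. *)

theory Submission
  imports Defs
begin

section \<open>Differences in sets of positive density\<close>

text \<open>Finiteness of the measure is the middle term because it makes far levels cheap: a
  function bounded by m costs at most m^p times the measure of the levels that carry it. So periodic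
  or translated copies of a function have small norm once they sit far from level 0.

  The harder half derives finiteness from recurrence. For one time n of E, the disjoint levels m - n
  with m in E have total measure below a constant, yet these levels may miss most of the integers.
  The constant is the same for all n, which permits averaging over n. Two one-sided facts shape the
  combinatorics: the density of E is only bounded below and need not exist as a limit, and the
  measure of a level is compared only with later levels. Hence gaps are closed upwards, towards a
  frequent difference at bounded distance.\<close>

definition diff_count :: "nat set \<Rightarrow> int \<Rightarrow> nat" where
  "diff_count A k = card {(a, b) \<in> A \<times> A. int b - int a = k}"

text \<open>A pair (a, b) with difference j - i corresponds to the common point a - i = b - j. Rare
  differences thus mean almost disjoint translates.\<close>

lemma diff_count_eq_card_Int:
  "diff_count A (j - i) = card ((\<lambda>a. int a - i) ` A \<inter> (\<lambda>a. int a - j) ` A)"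
proof -
  have "bij_betw (\<lambda>(a, b). int a - i) {(a, b) \<in> A \<times> A. int b - int a = j - i}
      ((\<lambda>a. int a - i) ` A \<inter> (\<lambda>a. int a - j) ` A)"
  proof (rule bij_betwI')
    fix y assume "y \<in> (\<lambda>a. int a - i) ` A \<inter> (\<lambda>a. int a - j) ` A"
    then obtain a b where "a \<in> A" "b \<in> A" "y = int a - i" "y = int b - j" by auto
    then show "\<exists>x\<in>{(a, b) \<in> A \<times> A. int b - int a = j - i}. y = (\<lambda>(a, b). int a - i) x"
      by (intro bexI[of _ "(a, b)"]) auto
  next
    fix x assume "x \<in> {(a, b) \<in> A \<times> A. int b - int a = j - i}"
    then obtain a b where "x = (a, b)" "a \<in> A" "b \<in> A" "int b - int a = j - i" by auto
    moreover from this have "int a - i = int b - j" by simp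
    ultimately show "(\<lambda>(a, b). int a - i) x \<in> (\<lambda>a. int a - i) ` A \<inter> (\<lambda>a. int a - j) ` A"
      by (auto intro: image_eqI[of _ _ a] image_eqI[of _ _ b])
  qed auto
  then show ?thesis
    unfolding diff_count_def by (rule bij_betw_same_card)
qed

lemma diff_count_uminus: "diff_count A (- k) = diff_count A k"
  using diff_count_eq_card_Int[of A 0 k] diff_count_eq_card_Int[of A k 0] by (simp add: Int_commute)

text \<open>A truncated inclusion-exclusion: joining a set to a union loses at most its overlaps
  with the earlier sets, and there are at most \<open>(card K)\<^sup>2\<close> overlaps
  altogether.\<close>

lemma card_UN_lower_bound:
  fixes A :: "'i \<Rightarrow> 'b set" and m e :: real
  assumes "finite K" and "\<And>i. i \<in> K \<Longrightarrow> finite (A i)" and "\<And>i. i \<in> K \<Longrightarrow> m \<le> card (A i)"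
    and "\<And>i j. i \<in> K \<Longrightarrow> j \<in> K \<Longrightarrow> i \<noteq> j \<Longrightarrow> card (A i \<inter> A j) \<le> e" and "0 \<le> e"
  shows "card K * m \<le> card (\<Union>i\<in>K. A i) + (card K)\<^sup>2 * e"
  using assms(1-4)
proof (induction K)
  case (insert i K)
  let ?U = "\<Union>j\<in>K. A j"
  have "card (A i \<inter> ?U) \<le> (\<Sum>j\<in>K. card (A i \<inter> A j))"
    using card_UN_le[OF insert.hyps(1), of "\<lambda>j. A i \<inter> A j"] by simp
  then have "real (card (A i \<inter> ?U)) \<le> (\<Sum>j\<in>K. real (card (A i \<inter> A j)))"
    by (metis of_nat_le_iff of_nat_sum)
  also have "\<dots> \<le> (\<Sum>j\<in>K. e)"
    using insert.hyps(2) by (intro sum_mono insert.prems(3)) auto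
  finally have 1: "card (A i \<inter> ?U) \<le> card K * e" by simp
  have "card (A i) + card ?U = card (A i \<union> ?U) + card (A i \<inter> ?U)"
    using insert by (intro card_Un_Int) auto
  then have 2: "real (card (A i)) + card ?U = card (A i \<union> ?U) + card (A i \<inter> ?U)"
    by (metis of_nat_add)
  have 3: "card K * m \<le> card ?U + (card K)\<^sup>2 * e"
    using insert by (intro insert.IH) auto
  have 4: "m \<le> card (A i)" using insert by auto
  have "card (insert i K) * m \<le> card (A i \<union> ?U) + (card K)\<^sup>2 * e + card K * e"
    using 1 2 3 4 insert.hyps by (simp add: algebra_simps)
  also have "\<dots> \<le> card (A i \<union> ?U) + (card (insert i K))\<^sup>2 * e"
    using insert.hyps \<open>0 \<le> e\<close> by (simp add: power2_eq_square algebra_simps)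
  finally show ?case by simp
qed simp

text \<open>A set of positive density has only boundedly many pairwise almost disjoint translates; a
  maximal family of such translates supplies the shifts in \<open>K\<close>. The infinite set \<open>S\<close> of scales
  is chosen together with \<open>K\<close>, which replaces a passage to a limiting density.\<close>

lemma frequent_differences_syndetic:
  fixes E :: "nat set"
  assumes "0 < \<delta>" and dens: "\<forall>\<^sub>F N in sequentially. \<delta> * real N \<le> card (E \<inter> {1..N})"
  obtains \<eta> :: real and K S where "0 < \<eta>" "finite K" "K \<noteq> {}" "infinite (S :: nat set)"
    "\<And>k. \<forall>\<^sub>F N in sequentially. N \<in> S \<longrightarrow> (\<exists>i\<in>K. \<eta> * N \<le> diff_count (E \<inter> {1..N}) (k - i))"
proof -
  \<comment> \<open>\<open>r\<close> translates, each with at least \<delta> N points, have 3N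
    points or more counted separately. With \<eta> = 1 / r^2 the overlaps account for at most N,
    while the union has at most N + 2b points. This is impossible once 2b < N, so \<open>r\<close>
    translates cannot be almost disjoint.\<close>
  define r where "r = nat \<lceil>3 / \<delta>\<rceil>"
  have r: "3 \<le> r * \<delta>" and r0: "0 < r"
  proof -
    have "3 / \<delta> \<le> r" unfolding r_def by linarith
    then show "3 \<le> r * \<delta>" "0 < r" using \<open>0 < \<delta>\<close> by (auto simp: field_simps intro: gr0I)
  qed
  define \<eta> where "\<eta> = 1 / (real r)\<^sup>2"
  have \<eta>: "0 < \<eta>" using r0 by (simp add: \<eta>_def)
  define sep where "sep K S \<longleftrightarrow> finite K \<and> infinite S \<and>
    (\<forall>N\<in>S. \<forall>i\<in>K. \<forall>j\<in>K. i \<noteq> j \<longrightarrow> diff_count (E \<inter> {1..N}) (j - i) < \<eta> * N)" for K and S :: "nat set"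
  have bound: "card K \<noteq> r" if "sep K S" for K S
  proof
    assume cK: "card K = r"
    define b where "b = (\<Sum>i\<in>K. nat \<bar>i\<bar>)"
    have b: "\<bar>i\<bar> \<le> int b" if "i \<in> K" for i
    proof -
      have "nat \<bar>i\<bar> \<le> b"
        unfolding b_def using that \<open>sep K S\<close> by (intro member_le_sum) (auto simp: sep_def)
      then show ?thesis by simp
    qed
    have "\<forall>\<^sub>F N in sequentially. \<delta> * real N \<le> card (E \<inter> {1..N}) \<and> 2 * b < N"
      using dens eventually_gt_at_top by (rule eventually_conj)
    then obtain N where N: "N \<in> S" "\<delta> * real N \<le> card (E \<inter> {1..N})" "2 * b < N"
      using \<open>sep K S\<close> unfolding sep_def eventually_sequentially infinite_nat_iff_unbounded_le by blast
    define A where "A i = (\<lambda>a. int a - i) ` (E \<inter> {1..N})" for i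
    have "card K * (\<delta> * N) \<le> card (\<Union>i\<in>K. A i) + (card K)\<^sup>2 * (\<eta> * N)"
    proof (rule card_UN_lower_bound)
      show "\<delta> * N \<le> card (A i)" for i
        unfolding A_def using N by (subst card_image) (auto simp: inj_on_def)
      fix i j assume "i \<in> K" "j \<in> K" "i \<noteq> j"
      then have "diff_count (E \<inter> {1..N}) (j - i) < \<eta> * N"
        using \<open>sep K S\<close> N(1) by (simp add: sep_def)
      then show "card (A i \<inter> A j) \<le> \<eta> * N"
        unfolding A_def diff_count_eq_card_Int by simp
    qed (use \<open>sep K S\<close> \<eta> in \<open>auto simp: sep_def A_def\<close>)
    also have "(card K)\<^sup>2 * (\<eta> * N) = N" using r0 by (simp add: cK \<eta>_def)
    also have "card (\<Union>i\<in>K. A i) \<le> card {1 - int b .. N + int b}"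
    proof (intro of_nat_mono card_mono subsetI)
      fix y assume "y \<in> (\<Union>i\<in>K. A i)"
      then obtain i a where "i \<in> K" "a \<in> {1..N}" "y = int a - i" by (auto simp: A_def)
      then show "y \<in> {1 - int b .. N + int b}" using b[of i] by auto
    qed simp
    finally have "card K * (\<delta> * N) \<le> 2 * N + 2 * b" by simp
    moreover have "3 * real N \<le> card K * (\<delta> * N)"
      using mult_right_mono[OF r, of N] by (simp add: cK mult.assoc)
    ultimately show False using N(3) by linarith
  qed
  have bound': "card K < r" if "sep K S" for K S
  proof (rule ccontr)
    assume "\<not> card K < r"
    then obtain K' where "K' \<subseteq> K" "card K' = r"
      by (metis linorder_not_less obtain_subset_with_card_n)
    moreover from this have "sep K' S"
      using \<open>sep K S\<close> unfolding sep_def by (meson finite_subset subsetD)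
    ultimately show False using bound by blast
  qed
  define P where "P n \<longleftrightarrow> (\<exists>K S. sep K S \<and> card K = n)" for n
  have P1: "P 1"
    unfolding P_def by (intro exI[of _ "{0}"] exI[of _ UNIV]) (auto simp: sep_def)
  have le_r: "n \<le> r" if "P n" for n
    using that bound' by (auto simp: P_def intro: less_imp_le)
  from P1 le_r have "P (Greatest P)" by (rule GreatestI_nat)
  have mx: "n \<le> Greatest P" if "P n" for n
    using that le_r by (rule Greatest_le_nat)
  from \<open>P (Greatest P)\<close> obtain K S where KS: "sep K S" "card K = Greatest P" unfolding P_def by auto
  have main: "\<forall>\<^sub>F N in sequentially. N \<in> S \<longrightarrow> (\<exists>i\<in>K. \<eta> * N \<le> diff_count (E \<inter> {1..N}) (k - i))" for k
  proof (cases "k \<in> K")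
    \<comment> \<open>The shift i = k gives difference 0, whose count is the number of points
      itself.\<close>
    case True
    have "\<forall>\<^sub>F N in sequentially. \<eta> * N \<le> diff_count (E \<inter> {1..N}) (k - k)"
      using dens
    proof eventually_elim
      case (elim N)
      have "diff_count (E \<inter> {1..N}) (k - k) = card (E \<inter> {1..N})"
        unfolding diff_count_eq_card_Int by (simp add: card_image inj_on_def)
      moreover have "\<eta> \<le> \<delta>"
      proof -
        have "1 \<le> real r" using r0 by simp
        then have "\<eta> \<le> 1 / r" unfolding \<eta>_def by (intro divide_left_mono) (auto simp: power2_eq_square)
        also have "\<dots> \<le> \<delta>" using r r0 by (simp add: field_simps)
        finally show ?thesis .
      qed
      then have "\<eta> * N \<le> \<delta> * N" by (simp add: mult_right_mono)
      ultimately show ?case using elim by simp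
    qed
    then show ?thesis by eventually_elim (use True in blast)
  next
    case False
    \<comment> \<open>The scales at which k fails. If there were infinitely many, adding k to
      \<open>K\<close> and restricting to these scales would contradict the maximality of
      \<open>K\<close>.\<close>
    define S' where "S' = {N \<in> S. \<forall>i\<in>K. diff_count (E \<inter> {1..N}) (k - i) < \<eta> * N}"
    have "finite S'"
    proof (rule ccontr)
      assume "infinite S'"
      have "diff_count A (i - k) = diff_count A (k - i)" for A i
        using diff_count_uminus[of A "k - i"] by simp
      then have "sep (insert k K) S'"
        using KS(1) \<open>infinite S'\<close> unfolding sep_def S'_def by auto
      then have "P (card (insert k K))" unfolding P_def by blast
      from mx[OF this] show False using False KS by (auto simp: sep_def)
    qed
    then obtain b where "\<forall>N\<in>S'. N < b" using finite_nat_bounded by (metis lessThan_iff subsetD)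
    then show ?thesis
      unfolding eventually_sequentially S'_def
      by (intro exI[of _ b]) (auto simp: not_less not_le)
  qed
  have "K \<noteq> {}" using mx[OF P1] KS by auto
  then show thesis
    using that \<eta> KS(1) main by (auto simp: sep_def)
qed

lemma bounded_sums_of_sums_over_differences:
  fixes w :: "int \<Rightarrow> real" and c \<delta> C :: real
  assumes "0 < \<delta>" and dens: "\<forall>\<^sub>F N in sequentially. \<delta> * real N \<le> card (E \<inter> {1..N})"
    and w0: "\<And>k. 0 \<le> w k" and wc: "\<And>k. w k \<le> c * w (k + 1)" and "1 \<le> c"
    and sums: "\<And>n F. n \<in> E \<Longrightarrow> finite F \<Longrightarrow> F \<subseteq> E \<Longrightarrow> (\<Sum>m\<in>F. w (int m - int n)) \<le> C"
  shows "\<exists>D. \<forall>F. finite F \<longrightarrow> sum w F \<le> D"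
proof (rule frequent_differences_syndetic[OF assms(1,2)])
  fix \<eta> :: real and K S
  assume "0 < \<eta>" and K: "finite K" "K \<noteq> {}" and "infinite (S :: nat set)"
    and syn: "\<And>k. \<forall>\<^sub>F N in sequentially. N \<in> S \<longrightarrow> (\<exists>i\<in>K. \<eta> * N \<le> diff_count (E \<inter> {1..N}) (k - i))"
  have C: "0 \<le> C"
  proof -
    obtain N where "0 < N" "\<delta> * real N \<le> card (E \<inter> {1..N})"
      using eventually_happens'[OF _ eventually_conj[OF eventually_gt_at_top[of 0] dens]] by auto
    moreover from this \<open>0 < \<delta>\<close> have "0 < \<delta> * real N" by simp
    ultimately have "E \<inter> {1..N} \<noteq> {}" by (intro notI) simp
    then obtain n where "n \<in> E" by auto
    then show ?thesis using sums[of n "{}"] by simp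
  qed
  \<comment> \<open>Syndeticity is applied to k + t instead of k: then k + t - i = k +
    \<open>s i\<close> with \<open>s i\<close> nonnegative, and the comparison \<open>wc\<close> is
    needed upwards only.\<close>
  define t where "t = Max K"
  define s where "s i = nat (t - i)" for i
  have s: "int (s i) = t - i" if "i \<in> K" for i
    using that K by (simp add: s_def t_def)
  define b where "b = sum s K"
  have sb: "s i \<le> b" if "i \<in> K" for i
    unfolding b_def using that K by (intro member_le_sum) auto
  have iter: "w k \<le> c ^ j * w (k + int j)" for k j
  proof (induction j)
    case (Suc j)
    have "c ^ j * w (k + int j) \<le> c ^ j * (c * w (k + int j + 1))"
      using wc \<open>1 \<le> c\<close> by (intro mult_left_mono) auto
    then show ?case using Suc by (simp add: algebra_simps)
  qed simp
  \<comment> \<open>The bound contains neither \<open>F\<close> nor the scale: as \<open>F\<close>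
    is finite, one scale N in S serves all its elements at once.\<close>
  have "sum w F \<le> card K * (c ^ b * (C / \<eta>))" if F: "finite F" for F
  proof -
    have "\<forall>\<^sub>F N in sequentially. 0 < N \<and> (\<forall>k\<in>F. N \<in> S \<longrightarrow>
        (\<exists>i\<in>K. \<eta> * N \<le> diff_count (E \<inter> {1..N}) (k + t - i)))"
      using F syn by (intro eventually_conj eventually_gt_at_top eventually_ball_finite) auto
    then obtain N\<^sub>0 where N\<^sub>0: "\<And>N. N\<^sub>0 \<le> N \<Longrightarrow> 0 < N \<and> (\<forall>k\<in>F. N \<in> S \<longrightarrow>
        (\<exists>i\<in>K. \<eta> * N \<le> diff_count (E \<inter> {1..N}) (k + t - i)))"
      unfolding eventually_sequentially by auto
    obtain N where "N\<^sub>0 \<le> N" and N: "N \<in> S"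
      using \<open>infinite S\<close> unfolding infinite_nat_iff_unbounded_le by auto
    then have "0 < N"
      and syn_N: "\<And>k. k \<in> F \<Longrightarrow> \<exists>i\<in>K. \<eta> * N \<le> diff_count (E \<inter> {1..N}) (k + t - i)"
      using N\<^sub>0 by auto
    note N = N this(1)
    define A where "A = E \<inter> {1..N}"
    have A: "finite A" "A \<subseteq> E" "card A \<le> N"
      unfolding A_def using card_mono[of "{1..N}" "E \<inter> {1..N}"] by auto
    \<comment> \<open>Double counting: each pair (a, b) of points of \<open>A\<close> contributes w
      (b - a) for at most one l. For fixed a the sum over b is at most C, and there are at most N
      points a.\<close>
    have weighted: "(\<Sum>l\<in>G. w l * diff_count A l) \<le> N * C" if G: "finite G" for G
    proof -
      have "(\<Sum>l\<in>G. w l * diff_count A l)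
          = (\<Sum>l\<in>G. \<Sum>x\<in>A \<times> A. if int (snd x) - int (fst x) = l then w l else 0)"
      proof (rule sum.cong[OF refl])
        fix l
        have "w l * diff_count A l = (\<Sum>x\<in>{x \<in> A \<times> A. int (snd x) - int (fst x) = l}. w l)"
          by (simp add: diff_count_def case_prod_beta' mem_Times_iff)
        also have "\<dots> = (\<Sum>x\<in>A \<times> A. if int (snd x) - int (fst x) = l then w l else 0)"
          by (rule sum.inter_filter) (use A in simp)
        finally show "w l * diff_count A l = \<dots>" .
      qed
      also have "\<dots> = (\<Sum>x\<in>A \<times> A. \<Sum>l\<in>G. if int (snd x) - int (fst x) = l then w l else 0)"
        by (rule sum.swap)
      also have "\<dots> \<le> (\<Sum>x\<in>A \<times> A. w (int (snd x) - int (fst x)))"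
        using G w0 by (intro sum_mono) simp
      also have "\<dots> = (\<Sum>a\<in>A. \<Sum>b\<in>A. w (int b - int a))"
        by (simp add: sum.cartesian_product case_prod_beta')
      also have "\<dots> \<le> (\<Sum>a\<in>A. C)"
        using A by (intro sum_mono sums) auto
      also have "\<dots> \<le> N * C"
        using A(3) C by (simp add: mult_right_mono)
      finally show ?thesis .
    qed
    \<comment> \<open>The elements of \<open>F\<close> for which the shift i works. These sets cover
      \<open>F\<close>; overlaps do no harm because w is nonnegative.\<close>
    define g where "g i = {k \<in> F. \<eta> * N \<le> diff_count A (k + t - i)}" for i
    have "sum w (g i) \<le> c ^ b * (C / \<eta>)" if i: "i \<in> K" for i
    proof -
      have "sum w (g i) \<le> (\<Sum>k\<in>g i. c ^ b * w (k + int (s i)))"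
      proof (rule sum_mono)
        fix k
        have "w k \<le> c ^ s i * w (k + int (s i))" by (rule iter)
        also have "\<dots> \<le> c ^ b * w (k + int (s i))"
          using sb[OF i] \<open>1 \<le> c\<close> w0 by (intro mult_right_mono power_increasing)
        finally show "w k \<le> c ^ b * w (k + int (s i))" .
      qed
      also have "\<dots> = c ^ b * (\<Sum>l\<in>(\<lambda>k. k + int (s i)) ` g i. w l)"
        by (simp add: sum_distrib_left sum.reindex inj_on_def)
      also have "\<dots> \<le> c ^ b * (\<Sum>l\<in>(\<lambda>k. k + int (s i)) ` g i. w l * diff_count A l / (\<eta> * N))"
      proof (intro mult_left_mono sum_mono)
        fix l assume "l \<in> (\<lambda>k. k + int (s i)) ` g i"
        then have "\<eta> * N \<le> diff_count A l" by (auto simp: g_def s[OF i] algebra_simps)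
        then have "w l * (\<eta> * N) \<le> w l * diff_count A l" using w0 by (intro mult_left_mono)
        then show "w l \<le> w l * diff_count A l / (\<eta> * N)"
          using \<open>0 < \<eta>\<close> N(2) by (simp add: field_simps)
      qed (use \<open>1 \<le> c\<close> in auto)
      also have "\<dots> \<le> c ^ b * (N * C / (\<eta> * N))"
        unfolding sum_divide_distrib[symmetric]
        using weighted F \<open>0 < \<eta>\<close> N(2) \<open>1 \<le> c\<close>
        by (intro mult_left_mono divide_right_mono) (auto simp: g_def)
      also have "\<dots> = c ^ b * (C / \<eta>)" using N(2) by simp
      finally show ?thesis .
    qed
    then have "(\<Sum>i\<in>K. sum w (g i)) \<le> card K * (c ^ b * (C / \<eta>))"
      by (rule sum_bounded_above)
    moreover have "sum w F \<le> (\<Sum>i\<in>K. sum w (g i))"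
    proof -
      have "sum w F \<le> (\<Sum>k\<in>F. \<Sum>i\<in>K. if k \<in> g i then w k else 0)"
      proof (rule sum_mono)
        fix k assume "k \<in> F"
        then obtain i where "i \<in> K" "k \<in> g i" using syn_N by (auto simp: g_def A_def)
        then have "(if k \<in> g i then w k else 0) \<le> (\<Sum>i\<in>K. if k \<in> g i then w k else 0)"
          using K w0 by (intro member_le_sum) auto
        then show "w k \<le> (\<Sum>i\<in>K. if k \<in> g i then w k else 0)"
          using \<open>k \<in> g i\<close> by simp
      qed
      also have "\<dots> = (\<Sum>i\<in>K. \<Sum>k\<in>F. if k \<in> g i then w k else 0)"
        by (rule sum.swap)
      also have "\<dots> = (\<Sum>i\<in>K. sum w (g i))"
        using F by (simp add: g_def sum.inter_filter)
      finally show ?thesis .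
    qed
    ultimately show ?thesis by linarith
  qed
  then show ?thesis by blast
qed

section \<open>Separated sets of positive density\<close>

text \<open>The integers \<open>i\<close> with 2-adic valuation \<open>s j\<close> are the indices of blocks of type \<open>j\<close>; the
  centre of a block of radius \<open>r\<close> has distance at least \<open>r\<close> from the neighbouring blocks. Since \<open>s\<close>
  grows fast, the blocks have bounded average length.\<close>

lemma separated_positive_density:
  fixes N :: "nat \<Rightarrow> nat"
  obtains A :: "nat \<Rightarrow> nat set"
  where "\<And>j n. n \<in> A j \<Longrightarrow> N j < n"
    and "\<And>j j' n n'. n \<in> A j \<Longrightarrow> n' \<in> A j' \<Longrightarrow> n < n' \<Longrightarrow> n + N j + N j' \<le> n'"
    and "\<And>j j'. j \<noteq> j' \<Longrightarrow> A j \<inter> A j' = {}"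
    and "\<And>j. \<exists>\<delta>>0. \<forall>\<^sub>F n in sequentially. \<delta> * real n \<le> card (A j \<inter> {1..n})"
proof -
  \<comment> \<open>Strictly increasing, so that distinct types have distinct valuations, and at
    least N j + j + 1, so that 2^j N j is at most D j = 2^(s j).\<close>
  define s where "s j = (\<Sum>i\<le>j. N i + i + 1)" for j
  define D :: "nat \<Rightarrow> nat" where "D j = 2 ^ s j" for j
  have s: "N j + j + 1 \<le> s j" for j
    by (cases j) (auto simp: s_def)
  have s_less: "s j < s j'" if "j < j'" for j j'
  proof -
    have "strict_mono s" unfolding strict_mono_Suc_iff by (simp add: s_def)
    then show ?thesis using that by (rule strict_monoD)
  qed
  have D: "2 ^ j * N j \<le> D j" "0 < D j" for j
  proof -
    have "2 ^ j * N j \<le> 2 ^ j * 2 ^ N j" by (intro mult_left_mono) (auto intro: less_imp_le)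
    also have "\<dots> \<le> D j"
      unfolding D_def power_add[symmetric] using s[of j] by (intro power_increasing) auto
    finally show "2 ^ j * N j \<le> D j" .
  qed (simp add: D_def)
  have D_gt: "j < D j" for j
    using s[of j] less_exp[of "s j"] unfolding D_def by linarith
  define I where "I j = {i. i mod (2 * D j) = D j}" for j
  have I_disj: "I j \<inter> I j' = {}" if "j < j'" for j j'
  proof (rule ccontr)
    assume "I j \<inter> I j' \<noteq> {}"
    then obtain i where i: "i mod (2 * D j) = D j" "i mod (2 * D j') = D j'" by (auto simp: I_def)
    have dv: "2 * D j dvd D j'"
      using s_less[OF that] unfolding D_def power_Suc[symmetric] by (intro le_imp_power_dvd) simp
    have "D j' dvd i"
      using i(2) by (metis dvd_refl dvd_triv_right dvd_mod_imp_dvd)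
    then have "2 * D j dvd i" using dv by (rule dvd_trans[rotated])
    then show False using i(1) D(2)[of j] by simp
  qed
  define g where "g i j = (if i \<in> I j then N j else 0)" for i j
  \<comment> \<open>The radius of block i. The sum may stop at i because membership of i in
    \<open>I j\<close> forces j < D j and D j <= i. The summand 1 gives blocks without a type
    positive length and makes N j < b i strict.\<close>
  define b where "b i = 1 + (\<Sum>j\<le>i. g i j)" for i
  have I_ge: "D j \<le> i" if "i \<in> I j" for i j
    using that unfolding I_def by (metis mem_Collect_eq mod_less_eq_dividend)
  have b_ge: "N j < b i" if "i \<in> I j" for i j
  proof -
    have "g i j \<le> (\<Sum>j\<le>i. g i j)"
      using I_ge[OF that] D_gt[of j] by (intro member_le_sum) auto
    then show ?thesis using that by (simp add: b_def g_def)
  qed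
  \<comment> \<open>Blocks of lengths 2 b 0, 2 b 1, ... are laid end to end; \<open>pos i\<close> is
    the centre of block i.\<close>
  define pos where "pos i = 2 * (\<Sum>k<i. b k) + b i" for i
  have pos_sep: "pos i + b i + b i' \<le> pos i'" if "i < i'" for i i'
  proof -
    have "(\<Sum>k<Suc i. b k) \<le> (\<Sum>k<i'. b k)"
      using that by (intro sum_mono2) auto
    then show ?thesis by (simp add: pos_def)
  qed
  have b_pos: "0 < b i" for i by (simp add: b_def)
  have pos_mono: "strict_mono pos"
  proof (rule strict_monoI)
    fix i i' :: nat assume "i < i'"
    then show "pos i < pos i'" using pos_sep[of i i'] b_pos[of i] by linarith
  qed
  have count: "card {i \<in> {..n}. i \<in> I j} * D j \<le> n" for n j
  proof -
    have "{i \<in> {..n}. i \<in> I j} \<subseteq> (\<lambda>q. D j * q) ` {1..n div D j}"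
    proof
      fix i assume "i \<in> {i \<in> {..n}. i \<in> I j}"
      then have i: "i \<le> n" "i mod (2 * D j) = D j" by (auto simp: I_def)
      have "D j dvd i" using i(2) by (metis dvd_refl dvd_triv_right dvd_mod_imp_dvd)
      then obtain q where q: "i = D j * q" by auto
      with i D(2)[of j] have "q \<noteq> 0" by (intro notI) simp
      moreover have "q \<le> n div D j"
        using i(1) q D(2)[of j] by (simp add: less_eq_div_iff_mult_less_eq mult.commute)
      ultimately show "i \<in> (\<lambda>q. D j * q) ` {1..n div D j}" using q by auto
    qed
    then have "card {i \<in> {..n}. i \<in> I j} \<le> card {1..n div D j}"
      by (rule surj_card_le[rotated]) simp
    then have "card {i \<in> {..n}. i \<in> I j} * D j \<le> n div D j * D j"
      by (intro mult_right_mono) auto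
    also have "\<dots> \<le> n" by simp
    finally show ?thesis .
  qed
  \<comment> \<open>The average radius is at most 3: the constant contributes 1 per index, and type
    j contributes at most N j / D j, hence at most 2^-j, for a total of 2.\<close>
  have sum_b: "real (\<Sum>i\<le>n. b i) \<le> 1 + 3 * real n" for n
  proof -
    have "(\<Sum>i\<le>n. b i) = Suc n + (\<Sum>i\<le>n. \<Sum>j\<le>i. g i j)"
      unfolding b_def by (simp only: sum.distrib) simp
    also have "(\<Sum>i\<le>n. \<Sum>j\<le>i. g i j) \<le> (\<Sum>i\<le>n. \<Sum>j\<le>n. g i j)"
      by (intro sum_mono sum_mono2) auto
    also have "\<dots> = (\<Sum>j\<le>n. \<Sum>i\<le>n. g i j)" by (rule sum.swap)
    also have "\<dots> = (\<Sum>j\<le>n. N j * card {i \<in> {..n}. i \<in> I j})"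
      unfolding g_def by (intro sum.cong refl, subst sum.inter_filter[symmetric]) auto
    finally have "(\<Sum>i\<le>n. b i) \<le> Suc n + (\<Sum>j\<le>n. N j * card {i \<in> {..n}. i \<in> I j})"
      by simp
    then have "real (\<Sum>i\<le>n. b i) \<le> real (Suc n + (\<Sum>j\<le>n. N j * card {i \<in> {..n}. i \<in> I j}))"
      by (rule of_nat_mono)
    then have 1: "real (\<Sum>i\<le>n. b i) \<le> 1 + real n + (\<Sum>j\<le>n. real (N j * card {i \<in> {..n}. i \<in> I j}))"
      by simp
    have "real (N j * card {i \<in> {..n}. i \<in> I j}) \<le> real n * (1/2) ^ j" for j
    proof -
      have "2 ^ j * (N j * card {i \<in> {..n}. i \<in> I j}) = (2 ^ j * N j) * card {i \<in> {..n}. i \<in> I j}"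
        by simp
      also have "\<dots> \<le> D j * card {i \<in> {..n}. i \<in> I j}"
        using D(1) by (rule mult_right_mono) simp
      also have "\<dots> \<le> n" using count[of n j] by (simp add: mult.commute)
      finally have "real (2 ^ j * (N j * card {i \<in> {..n}. i \<in> I j})) \<le> real n"
        by (simp only: of_nat_le_iff)
      then show ?thesis by (simp add: field_simps power_divide)
    qed
    then have "(\<Sum>j\<le>n. real (N j * card {i \<in> {..n}. i \<in> I j})) \<le> (\<Sum>j\<le>n. real n * (1/2) ^ j)"
      by (intro sum_mono)
    also have "\<dots> = real n * (\<Sum>j\<le>n. (1/2) ^ j)" by (simp add: sum_distrib_left)
    also have "\<dots> \<le> real n * 2"
    proof (intro mult_left_mono)
      show "(\<Sum>j\<le>n. (1/2) ^ j) \<le> (2::real)"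
        unfolding sum_gp0 by simp
    qed simp
    finally show ?thesis using 1 by simp
  qed
  have pos_le: "pos i \<le> 8 * i" if "0 < i" for i
  proof -
    have "(\<Sum>k\<le>i. b k) = (\<Sum>k<i. b k) + b i"
      by (metis lessThan_Suc_atMost sum.lessThan_Suc)
    then have "pos i \<le> 2 * (\<Sum>k\<le>i. b k)" by (simp add: pos_def)
    then have "real (pos i) \<le> 2 * real (\<Sum>k\<le>i. b k)"
      using of_nat_mono[of "pos i" "2 * (\<Sum>k\<le>i. b k)", where 'a = real] by simp
    also have "\<dots> \<le> 2 * (1 + 3 * real i)" using sum_b[of i] by (rule mult_left_mono) simp
    also have "\<dots> \<le> 8 * real i" using that by simp
    finally show ?thesis by linarith
  qed
  \<comment> \<open>The odd multiples D j (1 + 2q) with q < Q have type j and centres at most 16 D j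
    Q, which is at most n. Doubling 16 to 32 absorbs the rounding in Q, since Q is at least 2 for
    these n.\<close>
  have dens: "\<forall>\<^sub>F n in sequentially. 1 / real (32 * D j) * real n \<le> card (pos ` I j \<inter> {1..n})" for j
    using eventually_ge_at_top[of "32 * D j"]
  proof eventually_elim
    case (elim n)
    define Q where "Q = n div (16 * D j)"
    have "inj_on (\<lambda>q. pos (D j * (1 + 2 * q))) {..<Q}"
      using D(2)[of j] strict_mono_eq[OF pos_mono] by (auto simp: inj_on_def)
    moreover have "(\<lambda>q. pos (D j * (1 + 2 * q))) ` {..<Q} \<subseteq> pos ` I j \<inter> {1..n}"
    proof safe
      fix q assume "q < Q"
      have "D j * (1 + 2 * q) = D j + q * (2 * D j)" by (simp add: algebra_simps)
      then have "D j * (1 + 2 * q) mod (2 * D j) = D j mod (2 * D j)" by (simp only: mod_mult_self1)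
      then show "pos (D j * (1 + 2 * q)) \<in> pos ` I j"
        using D(2)[of j] unfolding I_def by (intro imageI) simp
      have "1 \<le> b (D j * (1 + 2 * q))" using b_pos by (simp add: Suc_le_eq)
      then have "1 \<le> pos (D j * (1 + 2 * q))" by (simp add: pos_def)
      moreover have "pos (D j * (1 + 2 * q)) \<le> 8 * (D j * (1 + 2 * q))"
        using D(2)[of j] by (intro pos_le) simp
      moreover have "8 * (D j * (1 + 2 * q)) \<le> 16 * D j * Q"
      proof -
        have "D j * (1 + 2 * q) \<le> D j * (2 * Q)" using \<open>q < Q\<close> by (intro mult_left_mono) auto
        then show ?thesis by simp
      qed
      moreover have "16 * D j * Q \<le> n" unfolding Q_def by simp
      ultimately show "pos (D j * (1 + 2 * q)) \<in> {1..n}" by simp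
    qed
    ultimately have "Q \<le> card (pos ` I j \<inter> {1..n})"
      using card_inj_on_le[of _ "{..<Q}" "pos ` I j \<inter> {1..n}"] by simp
    moreover have "real n / real (32 * D j) \<le> real Q"
    proof -
      have "n = 16 * D j * Q + n mod (16 * D j)" unfolding Q_def by simp
      moreover have "n mod (16 * D j) < 16 * D j" using D(2)[of j] by simp
      ultimately have n_less: "n < 16 * D j * (Q + 1)" by (simp add: algebra_simps)
      have "2 * (16 * D j) \<le> n" using elim by simp
      then have "2 \<le> Q" unfolding Q_def using D(2)[of j] by (simp add: less_eq_div_iff_mult_less_eq)
      then have "16 * D j * (Q + 1) \<le> 16 * D j * (2 * Q)" by (intro mult_left_mono) auto
      also have "\<dots> = 32 * D j * Q" by simp
      finally have "n \<le> 32 * D j * Q" using n_less by (meson le_trans less_imp_le)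
      then have "real n \<le> real (32 * D j) * real Q" by (metis of_nat_le_iff of_nat_mult)
      then show ?thesis using D(2)[of j] by (simp add: divide_le_eq mult.commute)
    qed
    ultimately show ?case by simp
  qed
  show thesis
  proof (rule that[of "\<lambda>j. pos ` I j"])
    fix j n assume "n \<in> pos ` I j"
    then obtain i where "i \<in> I j" "n = pos i" by auto
    then show "N j < n" using b_ge[of i j] by (simp add: pos_def)
  next
    fix j j' n n' assume "n \<in> pos ` I j" "n' \<in> pos ` I j'" "n < n'"
    then obtain i i' where "i \<in> I j" "n = pos i" "i' \<in> I j'" "n' = pos i'" by auto
    moreover from this have "i < i'" using \<open>n < n'\<close> strict_mono_less[OF pos_mono] by simp
    ultimately show "n + N j + N j' \<le> n'"
      using pos_sep[of i i'] b_ge[of i j] b_ge[of i' j'] by linarith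
  next
    fix j j' :: nat assume "j \<noteq> j'"
    then have "I j \<inter> I j' = {}" using I_disj by (metis Int_commute linorder_neqE_nat)
    then show "pos ` I j \<inter> pos ` I j' = {}"
      using strict_mono_eq[OF pos_mono] by auto
  next
    fix j
    show "\<exists>\<delta>>0. \<forall>\<^sub>F n in sequentially. \<delta> * real n \<le> card (pos ` I j \<inter> {1..n})"
      using dens[of j] D(2)[of j] by (intro exI[of _ "1 / real (32 * D j)"]) simp
  qed
qed

section \<open>Iterates of the system\<close>

context measurable_system
begin

abbreviation it :: "int \<Rightarrow> 'a \<Rightarrow> 'a" where
  "it \<equiv> int_iterate (space M) f"

lemma it_of_nat: "it (int n) = f ^^ n"
  by (simp add: int_iterate_def)

lemma it_0 [simp]: "it 0 = id"
  by (simp add: int_iterate_def id_def)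

lemma bij_betw_it: "bij_betw (it n) (space M) (space M)"
  unfolding int_iterate_def using bij_betw_funpow[OF bij] bij_betw_funpow[OF bij_betw_inv_into[OF bij]]
  by auto

lemma it_in_space: "x \<in> space M \<Longrightarrow> it n x \<in> space M"
  using bij_betw_it bij_betwE by blast

lemma it_Suc: "it (n + 1) x = f (it n x)" if "x \<in> space M"
proof (cases "0 \<le> n")
  case True
  then show ?thesis by (simp add: int_iterate_def nat_add_distrib)
next
  case False
  define j where "j = nat (- n) - 1"
  have n: "n = - int (Suc j)" using False by (simp add: j_def)
  have "it (n + 1) x = (inv_into (space M) f ^^ j) x"
  \<comment> \<open>For j = 0 the exponent n + 1 is 0, where \<open>int_iterate\<close> has already
    switched to its nonnegative branch.\<close>
  proof (cases "j = 0")
    case False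
    then have "\<not> 0 \<le> n + 1" "nat (- (n + 1)) = j" using n by auto
    then show ?thesis by (simp only: int_iterate_def if_False)
  qed (simp add: n)
  moreover have "it n x = inv_into (space M) f ((inv_into (space M) f ^^ j) x)"
    by (simp add: n int_iterate_def nat_add_distrib)
  moreover have "(inv_into (space M) f ^^ j) x \<in> space M"
    using bij_betw_funpow[OF bij_betw_inv_into[OF bij], of j] that bij_betwE by blast
  ultimately show ?thesis using bij by (simp add: bij_betw_inv_into_right)
qed

lemma it_add: "it (m + n) x = it m (it n x)" if x: "x \<in> space M"
proof (induction m rule: int_induct[where k = 0])
  case (step1 m)
  have "it (m + 1 + n) x = it (m + n + 1) x" by (simp add: ac_simps)
  then show ?case using step1 x by (simp add: it_Suc it_in_space)
next
  \<comment> \<open>The downward step applies f to both sides, so that the upward law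
    \<open>it_Suc\<close> can be used, and cancels f by injectivity.\<close>
  case (step2 m)
  have "f (it (m - 1 + n) x) = it (m - 1 + n + 1) x" using x by (simp only: it_Suc)
  also have "\<dots> = it (m + n) x" by (simp add: algebra_simps)
  also have "\<dots> = it (m - 1 + 1) (it n x)" using step2 by simp
  also have "\<dots> = f (it (m - 1) (it n x))" by (rule it_Suc) (simp add: it_in_space x)
  finally show ?case
    using bij_betw_imp_inj_on[OF bij] x by (simp add: inj_on_eq_iff it_in_space)
qed simp

lemma it_uminus_it: "x \<in> space M \<Longrightarrow> it (- n) (it n x) = x"
  and it_it_uminus: "x \<in> space M \<Longrightarrow> it n (it (- n) x) = x"
  using it_add[of x "- n" n] it_add[of x n "- n"] by simp_all

lemma it_image_eq_vimage: "B \<subseteq> space M \<Longrightarrow> it n ` B = it (- n) -` B \<inter> space M"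
proof (intro equalityI subsetI)
  fix x assume "B \<subseteq> space M" "x \<in> it (- n) -` B \<inter> space M"
  then show "x \<in> it n ` B"
    by (intro image_eqI[of _ _ "it (- n) x"]) (auto simp: it_it_uminus)
qed (auto simp: it_uminus_it it_in_space subset_iff)

lemma measurable_it [measurable]: "it n \<in> measurable M M"
proof -
  have "inv_into (space M) f \<in> measurable M M"
  proof (rule measurableI)
    fix B assume B: "B \<in> sets M"
    have "inv_into (space M) f -` B \<inter> space M = f ` B"
      using bij sets.sets_into_space[OF B]
      by (auto simp: bij_betw_inv_into_left bij_betw_inv_into_right subset_iff
          intro!: image_eqI[of _ f "inv_into (space M) f _"] dest: bij_betwE)
    then show "inv_into (space M) f -` B \<inter> space M \<in> sets M" using image_sets[OF B] by simp
  qed (use bij_betw_inv_into[OF bij] bij_betwE in blast)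
  moreover have "g ^^ n \<in> measurable M M" if "g \<in> measurable M M" for g n
    using that by (induction n) auto
  ultimately show ?thesis using measurable_f by (simp add: int_iterate_def)
qed

lemma it_image_sets [measurable]: "B \<in> sets M \<Longrightarrow> it n ` B \<in> sets M"
  using it_image_eq_vimage[OF sets.sets_into_space] measurable_sets[OF measurable_it] by metis

text \<open>The set \<open>it n\<close> B\<open>lies in the preimage under f of\<close>it (n + 1)
  \<open>B\<close>, so boundedness compares a set with its next image. The constant is raised to at
  least 1 to make its powers increasing.\<close>

lemma emeasure_it_image_le:
  obtains c :: real where "1 \<le> c"
    "\<And>B n. B \<in> sets M \<Longrightarrow> emeasure M (it n ` B) \<le> ennreal c * emeasure M (it (n + 1) ` B)"
proof -
  obtain c where "0 < c"
    and c: "\<And>B. B \<in> sets M \<Longrightarrow> emeasure M (f -` B \<inter> space M) \<le> ennreal c * emeasure M B"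
    using bounded by blast
  show thesis
  proof (rule that[of "max 1 c"])
    fix B n assume B: "B \<in> sets M"
    have "it n ` B \<subseteq> f -` (it (n + 1) ` B) \<inter> space M"
      using sets.sets_into_space[OF B] by (auto simp: it_Suc it_in_space subset_iff image_iff)
    then have "emeasure M (it n ` B) \<le> emeasure M (f -` (it (n + 1) ` B) \<inter> space M)"
      using B by (intro emeasure_mono vimage_sets it_image_sets)
    also have "\<dots> \<le> ennreal c * emeasure M (it (n + 1) ` B)" using B by (intro c it_image_sets)
    also have "\<dots> \<le> ennreal (max 1 c) * emeasure M (it (n + 1) ` B)"
      by (intro mult_right_mono ennreal_leI) auto
    finally show "emeasure M (it n ` B) \<le> ennreal (max 1 c) * emeasure M (it (n + 1) ` B)" .
  qed simp
qed

lemma Lp_fun_funpow: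
  assumes "1 \<le> p" and "u \<in> Lp_fun M p"
  shows "(\<lambda>x. u ((f ^^ n) x)) \<in> Lp_fun M p"
proof (induction n)
  case (Suc n)
  have "(\<lambda>x. u ((f ^^ n) x)) \<circ> f \<in> Lp_fun M p" using Suc Lp_compose assms(1) by metis
  then show ?case by (simp add: o_def funpow_swap1)
qed (use assms in simp)

lemma composition_operator_funpow_class:
  assumes "1 \<le> p" and "u \<in> Lp_fun M p"
  shows "(composition_operator M p f ^^ n) (Lp_class M p u) = Lp_class M p (\<lambda>x. u ((f ^^ n) x))"
proof (induction n)
  case (Suc n)
  then show ?case
    using composition_operator_class[OF assms(1) Lp_fun_funpow[OF assms, of n]]
    by (simp add: o_def) (simp add: funpow_swap1)
qed simp

end

section \<open>Membership and norm estimates in L^p through nonnegative integrals\<close>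

lemma Lp_funI:
  fixes u :: "'a \<Rightarrow> 'k::{real_normed_field, euclidean_space}"
  assumes "u \<in> borel_measurable M" and "(\<integral>\<^sup>+x. ennreal (norm (u x) powr p) \<partial>M) < \<infinity>"
  shows "u \<in> Lp_fun M p"
  using assms unfolding Lp_fun_def by (auto intro!: integrableI_bounded)

lemma Lp_norm_powr_nn:
  assumes "1 \<le> p" and "u \<in> Lp_fun M p"
  shows "ennreal (Lp_norm M p u powr p) = (\<integral>\<^sup>+x. ennreal (norm (u x) powr p) \<partial>M)"
  using assms by (subst nn_integral_eq_integral) (auto simp: Lp_fun_def Lp_norm_powr)

lemma powr_le_cancel:
  fixes a b p :: real
  assumes "a powr p \<le> b powr p" "0 < p" "0 \<le> a" "0 \<le> b"
  shows "a \<le> b"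
  using powr_less_mono2[of p b a] assms by linarith

lemma Lp_norm_leI:
  assumes "1 \<le> p" and "u \<in> Lp_fun M p" and "0 \<le> e"
    and "(\<integral>\<^sup>+x. ennreal (norm (u x) powr p) \<partial>M) \<le> ennreal (e powr p)"
  shows "Lp_norm M p u \<le> e"
proof (rule powr_le_cancel)
  show "Lp_norm M p u powr p \<le> e powr p"
    using assms(4) unfolding Lp_norm_powr_nn[OF assms(1,2), symmetric] by simp
qed (use assms in auto)

lemma Lp_norm_mono:
  assumes "1 \<le> p" and "u \<in> Lp_fun M p" and "v \<in> Lp_fun M p"
    and "\<And>x. x \<in> space M \<Longrightarrow> norm (u x) \<le> norm (v x)"
  shows "Lp_norm M p u \<le> Lp_norm M p v"
proof (rule Lp_norm_leI)
  show "(\<integral>\<^sup>+x. ennreal (norm (u x) powr p) \<partial>M) \<le> ennreal (Lp_norm M p v powr p)"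
    unfolding Lp_norm_powr_nn[OF assms(1,3)] using assms
    by (intro nn_integral_mono ennreal_leI powr_mono2) auto
qed (use assms in auto)

section \<open>Levels of the tower\<close>

text \<open>The last assumption keeps the lower half of bounded distortion, without quotients.\<close>

locale distorted_tower = measurable_system +
  fixes W :: "'a set" and K :: real
  assumes W_sets [measurable]: "W \<in> sets M"
    and W_disjoint: "disjoint_family (\<lambda>n. it n ` W)"
    and W_cover: "space M = (\<Union>n. it n ` W)"
    and W_pos: "0 < emeasure M W"
    and W_finite: "emeasure M W < \<infinity>"
    and distortion: "\<And>n C. C \<in> sets M \<Longrightarrow> C \<subseteq> W \<Longrightarrow>
      emeasure M (it n ` W) * emeasure M C \<le> ennreal K * emeasure M W * emeasure M (it n ` C)"
begin

definition level :: "'a \<Rightarrow> int" where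
  "level x = (THE n. x \<in> it n ` W)"

lemma level_eqI: "x \<in> it n ` W \<Longrightarrow> level x = n"
  unfolding level_def using W_disjoint
  by (intro the_equality) (auto simp: disjoint_family_on_def)

lemma in_level: "x \<in> space M \<Longrightarrow> x \<in> it (level x) ` W"
  using level_eqI by (metis UN_E W_cover)

lemma mem_it_image_W_iff: "x \<in> it n ` W \<longleftrightarrow> x \<in> space M \<and> level x = n"
  using level_eqI in_level W_cover by blast

lemma W_subset: "W \<subseteq> space M"
  using sets.sets_into_space[OF W_sets] .

lemma level_it:
  assumes "x \<in> space M"
  shows "level (it n x) = level x + n"
proof (rule level_eqI)
  obtain y where y: "y \<in> W" "x = it (level x) y" using in_level[OF assms] by blast
  then have "it n x = it (n + level x) y" using W_subset it_add[of y n "level x"] by auto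
  then show "it n x \<in> it (level x + n) ` W" using y(1) by (simp add: add.commute)
qed

lemma level_funpow: "x \<in> space M \<Longrightarrow> level ((f ^^ n) x) = level x + int n"
  using level_it[of x "int n"] by (simp add: it_of_nat)

lemma funpow_in_space: "x \<in> space M \<Longrightarrow> (f ^^ n) x \<in> space M"
  using it_in_space[of x "int n"] by (simp add: it_of_nat)

lemma measurable_level [measurable]: "level \<in> measurable M (count_space UNIV)"
proof (rule measurable_count_space_eq2_countable[THEN iffD2], safe)
  fix n
  have "level -` {n} \<inter> space M = it n ` W" using mem_it_image_W_iff by auto
  then show "level -` {n} \<inter> space M \<in> sets M" by simp
qed auto

definition tail :: "nat \<Rightarrow> 'a set" where
  "tail q = {x \<in> space M. int q \<le> \<bar>level x\<bar>}"

lemma tail_sets [measurable]: "tail q \<in> sets M"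
proof -
  have "tail q = level -` {l. int q \<le> \<bar>l\<bar>} \<inter> space M" by (auto simp: tail_def)
  also have "\<dots> \<in> sets M" by (rule measurable_sets[OF measurable_level]) simp
  finally show ?thesis .
qed

text \<open>Tails decrease to the empty set because every point has a finite level. A general finite
  measure \<open>N\<close> is allowed since the lemma is applied both to \<open>M\<close> and to a
  measure with a density.\<close>

lemma tail_tendsto_0:
  assumes "finite_measure N" and N: "sets N = sets M"
  shows "(\<lambda>q. emeasure N (tail q)) \<longlonglongrightarrow> 0"
proof -
  have "(\<lambda>q. emeasure N (tail q)) \<longlonglongrightarrow> emeasure N (\<Inter>q. tail q)"
  proof (rule Lim_emeasure_decseq)
    show "range tail \<subseteq> sets N" unfolding N by (intro image_subsetI tail_sets)
    show "decseq tail" by (auto simp: decseq_def tail_def)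
    show "emeasure N (tail q) \<noteq> \<infinity>" for q
      using finite_measure.emeasure_finite[OF assms(1)] by simp
  qed
  moreover have "(\<Inter>q. tail q) = {}"
  proof (rule ccontr)
    assume "(\<Inter>q. tail q) \<noteq> {}"
    then obtain x where "x \<in> (\<Inter>q. tail q)" by blast
    then have "x \<in> tail (nat \<bar>level x\<bar> + 1)" by blast
    then show False by (simp add: tail_def)
  qed
  ultimately show ?thesis by simp
qed

text \<open>The space is the disjoint union of the levels. Countable additivity speaks of sequences,
  so the integers are enumerated by \<open>int_decode\<close>, and each partial sum runs over a
  finite set of levels.\<close>

lemma finite_space_of_bounded_sums:
  assumes "D < \<infinity>" and "\<And>F. finite F \<Longrightarrow> (\<Sum>n\<in>F. emeasure M (it n ` W)) \<le> D"
  shows "emeasure M (space M) < \<infinity>"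
proof -
  have "(\<Union>i. it (int_decode i) ` W) = (\<Union>n\<in>range int_decode. it n ` W)" by blast
  also have "\<dots> = space M" unfolding surj_int_decode by (rule W_cover[symmetric])
  finally have "emeasure M (space M) = emeasure M (\<Union>i. it (int_decode i) ` W)" by simp
  also have "\<dots> = (\<Sum>i. emeasure M (it (int_decode i) ` W))"
    using W_disjoint inj_int_decode
    by (subst suminf_emeasure) (auto simp: disjoint_family_on_def inj_eq)
  also have "\<dots> \<le> D"
    unfolding suminf_eq_SUP
  proof (rule SUP_least)
    fix n
    have "(\<Sum>i<n. emeasure M (it (int_decode i) ` W)) = (\<Sum>k\<in>int_decode ` {..<n}. emeasure M (it k ` W))"
      by (subst sum.reindex) (auto intro: inj_on_subset[OF inj_int_decode])
    then show "(\<Sum>i<n. emeasure M (it (int_decode i) ` W)) \<le> D" using assms(2) by simp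
  qed
  finally show ?thesis using assms(1) by (rule le_less_trans)
qed

text \<open>Passes from sets to functions by comparing two measures: M restricted to W and pushed
  forward by \<open>it n\<close>, and M restricted to level n, suitably scaled. On a set A the
  comparison is \<open>distortion\<close> for the part of W that \<open>it n\<close> maps into
  A.\<close>

lemma distortion_nn_integral:
  assumes h [measurable]: "h \<in> borel_measurable M"
  shows "emeasure M (it n ` W) * (\<integral>\<^sup>+x. h (it n x) * indicator W x \<partial>M)
    \<le> ennreal K * emeasure M W * (\<integral>\<^sup>+x. h x * indicator (it n ` W) x \<partial>M)"
proof -
  let ?P = "distr (density M (indicator W)) M (it n)"
  let ?Q = "density M (indicator (it n ` W))"
  have m: "it n \<in> measurable (density M (indicator W)) M" by simp
  have le: "scale_measure (emeasure M (it n ` W)) ?P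
      \<le> scale_measure (ennreal K * emeasure M W) ?Q"
  proof (subst le_measure)
    show "\<forall>A\<in>sets (scale_measure (emeasure M (it n ` W)) ?P).
        emeasure (scale_measure (emeasure M (it n ` W)) ?P) A
        \<le> emeasure (scale_measure (ennreal K * emeasure M W) ?Q) A"
    proof
      fix A assume "A \<in> sets (scale_measure (emeasure M (it n ` W)) ?P)"
      then have A [measurable]: "A \<in> sets M" by simp
      have "emeasure ?P A = emeasure M (W \<inter> (it n -` A \<inter> space M))"
        by (subst emeasure_distr[OF m]) (simp_all add: emeasure_restricted)
      moreover have "emeasure ?Q A = emeasure M (it n ` (W \<inter> (it n -` A \<inter> space M)))"
      proof -
        have "it n ` (W \<inter> (it n -` A \<inter> space M)) = it n ` W \<inter> A"
          using W_subset by auto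
        then show ?thesis by (simp add: emeasure_restricted)
      qed
      ultimately show "emeasure (scale_measure (emeasure M (it n ` W)) ?P) A
        \<le> emeasure (scale_measure (ennreal K * emeasure M W) ?Q) A"
        by (simp add: distortion)
    qed
  qed (auto simp: sets_scale_measure)
  have "emeasure M (it n ` W) * (\<integral>\<^sup>+x. h (it n x) * indicator W x \<partial>M)
      = integral\<^sup>N (scale_measure (emeasure M (it n ` W)) ?P) h"
    by (subst nn_integral_scale_measure)
      (auto simp: nn_integral_distr[OF m] nn_integral_density mult.commute)
  also have "\<dots> \<le> integral\<^sup>N (scale_measure (ennreal K * emeasure M W) ?Q) h"
    using le by (intro nn_integral_mono_measure) (auto simp: sets_scale_measure)
  also have "\<dots> = ennreal K * emeasure M W * (\<integral>\<^sup>+x. h x * indicator (it n ` W) x \<partial>M)"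
    by (subst nn_integral_scale_measure) (auto simp: nn_integral_density mult.commute)
  finally show ?thesis .
qed

text \<open>With W as the given set and its measure as the error, (SC) yields a non-null part
  \<open>B\<close> of W, and distortion bounds the levels by the images of \<open>B\<close>.
  Conversely, a finite measure allows a tail of small measure to be removed; what remains meets
  finitely many levels, and the images of a single level are disjoint.\<close>

lemma summability_iff_finite: "summability_condition M f \<longleftrightarrow> emeasure M (space M) < \<infinity>"
proof
  assume sc: "summability_condition M f"
  define \<epsilon> where "\<epsilon> = measure M W"
  have eW: "emeasure M W = ennreal \<epsilon>"
    using W_finite by (simp add: \<epsilon>_def emeasure_eq_ennreal_measure)
  then have "0 < \<epsilon>" using W_pos by simp
  with sc W_finite obtain B where B: "B \<in> sets M" "B \<subseteq> W" "emeasure M (W - B) < ennreal \<epsilon>"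
    and sum: "(\<Sum>\<^sub>\<infinity>n\<in>UNIV. emeasure M (it n ` B)) < \<infinity>"
    unfolding summability_condition_def using W_sets by meson
  have Bpos: "emeasure M B \<noteq> 0"
  proof
    assume "emeasure M B = 0"
    then have "emeasure M (W - B) = emeasure M W"
      using B by (intro emeasure_Diff_null_set) auto
    then show False using B(3) eW by simp
  qed
  have Bfin: "emeasure M B < \<infinity>"
    using emeasure_mono[OF B(2) W_sets] W_finite by (rule le_less_trans)
  define D where "D = ennreal K * emeasure M W * (\<Sum>\<^sub>\<infinity>n\<in>UNIV. emeasure M (it n ` B)) / emeasure M B"
  show "emeasure M (space M) < \<infinity>"
  proof (rule finite_space_of_bounded_sums[of D])
    show "D < \<infinity>"
      unfolding D_def using sum W_finite Bpos
      by (simp add: ennreal_divide_eq_top_iff less_top[symmetric] ennreal_mult_eq_top_iff)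
    fix F :: "int set" assume F: "finite F"
    have "(\<Sum>n\<in>F. emeasure M (it n ` W)) * emeasure M B
        = (\<Sum>n\<in>F. emeasure M (it n ` W) * emeasure M B)"
      by (rule sum_distrib_right)
    also have "\<dots> \<le> (\<Sum>n\<in>F. ennreal K * emeasure M W * emeasure M (it n ` B))"
      using B by (intro sum_mono distortion) auto
    also have "\<dots> = ennreal K * emeasure M W * (\<Sum>n\<in>F. emeasure M (it n ` B))"
      by (rule sum_distrib_left[symmetric])
    also have "\<dots> \<le> ennreal K * emeasure M W * (\<Sum>\<^sub>\<infinity>n\<in>UNIV. emeasure M (it n ` B))"
    proof (rule mult_left_mono)
      show "(\<Sum>n\<in>F. emeasure M (it n ` B)) \<le> (\<Sum>\<^sub>\<infinity>n\<in>UNIV. emeasure M (it n ` B))"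
        using F by (subst nonneg_infsum_complete) (auto intro!: SUP_upper)
    qed simp
    finally have "(\<Sum>n\<in>F. emeasure M (it n ` W)) * emeasure M B / emeasure M B \<le> D"
      unfolding D_def by (rule divide_right_mono_ennreal)
    then show "(\<Sum>n\<in>F. emeasure M (it n ` W)) \<le> D"
      using Bpos Bfin by (simp add: ennreal_mult_divide_eq)
  qed
next
  assume fin: "emeasure M (space M) < \<infinity>"
  then have fm: "finite_measure M" by (intro finite_measureI) auto
  show "summability_condition M f"
    unfolding summability_condition_def
  proof (intro allI ballI impI)
    fix \<epsilon> :: real and B assume B: "B \<in> sets M" and \<epsilon>: "0 < \<epsilon> \<and> emeasure M B < \<infinity>"
    have "\<forall>\<^sub>F q in sequentially. emeasure M (tail q) < ennreal \<epsilon>"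
      using tail_tendsto_0[OF fm refl] \<epsilon> by (intro order_tendstoD) auto
    then obtain q where q: "emeasure M (tail q) < ennreal \<epsilon>"
      using eventually_happens' sequentially_bot by blast
    define B' where "B' = B - tail q"
    have B'[measurable]: "B' \<in> sets M" using B by (simp add: B'_def)
    have "emeasure M (B - B') \<le> emeasure M (tail q)"
      by (intro emeasure_mono) (auto simp: B'_def)
    then have 1: "emeasure M (B - B') < ennreal \<epsilon>" using q by (rule le_less_trans)
    let ?I = "{- int q .. int q}"
    have "(\<Sum>n\<in>F. emeasure M (it n ` B')) \<le> of_nat (card ?I) * emeasure M (space M)"
      if F: "finite F" for F
    proof -
      have "(\<Sum>n\<in>F. emeasure M (it n ` B')) \<le> (\<Sum>n\<in>F. \<Sum>k\<in>?I. emeasure M (it (n + k) ` W))"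
      proof (rule sum_mono)
        fix n
        have "it n ` B' \<subseteq> (\<Union>k\<in>?I. it (n + k) ` W)"
        proof safe
          fix x assume x: "x \<in> B'"
          then have "x \<in> space M" using sets.sets_into_space[OF B'] by auto
          moreover from this x have "level x \<in> ?I" by (auto simp: B'_def tail_def)
          ultimately show "it n x \<in> (\<Union>k\<in>?I. it (n + k) ` W)"
            by (intro UN_I[of "level x"]) (auto simp: mem_it_image_W_iff level_it it_in_space)
        qed
        then have "emeasure M (it n ` B') \<le> emeasure M (\<Union>k\<in>?I. it (n + k) ` W)"
          by (intro emeasure_mono) auto
        also have "\<dots> \<le> (\<Sum>k\<in>?I. emeasure M (it (n + k) ` W))"
          by (intro emeasure_subadditive_finite) auto
        finally show "emeasure M (it n ` B') \<le> (\<Sum>k\<in>?I. emeasure M (it (n + k) ` W))" .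
      qed
      also have "\<dots> = (\<Sum>k\<in>?I. \<Sum>n\<in>F. emeasure M (it (n + k) ` W))" by (rule sum.swap)
      also have "\<dots> \<le> (\<Sum>k\<in>?I. emeasure M (space M))"
      proof (rule sum_mono)
        fix k
        have "(\<Sum>n\<in>F. emeasure M (it (n + k) ` W)) = emeasure M (\<Union>n\<in>F. it (n + k) ` W)"
          using F W_disjoint by (intro sum_emeasure) (auto simp: disjoint_family_on_def)
        also have "\<dots> \<le> emeasure M (space M)" by (rule emeasure_space)
        finally show "(\<Sum>n\<in>F. emeasure M (it (n + k) ` W)) \<le> emeasure M (space M)" .
      qed
      finally show ?thesis by simp
    qed
    then have "(\<Sum>\<^sub>\<infinity>n\<in>UNIV. emeasure M (it n ` B')) \<le> of_nat (card ?I) * emeasure M (space M)"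
      by (subst nonneg_infsum_complete) (auto intro!: SUP_least)
    also have "\<dots> < \<infinity>" using fin by (simp add: ennreal_mult_less_top of_nat_less_top)
    finally have "(\<Sum>\<^sub>\<infinity>n\<in>UNIV. emeasure M (it n ` B')) < \<infinity>" .
    then show "\<exists>B'\<in>sets M. B' \<subseteq> B \<and> emeasure M (B - B') < ennreal \<epsilon> \<and>
        (\<Sum>\<^sub>\<infinity>n\<in>UNIV. emeasure M (it n ` B')) < \<infinity>"
      using 1 B' by (intro bexI[of _ B']) (auto simp: B'_def)
  qed
qed

subsection \<open>Frequent returns force finite measure\<close>

lemma nn_integral_norm_indicator:
  "(\<integral>\<^sup>+x. ennreal (norm (indicator W x :: 'k::{real_normed_field, euclidean_space}) powr p) \<partial>M)
    = emeasure M W"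
proof -
  have "(\<integral>\<^sup>+x. ennreal (norm (indicator W x :: 'k) powr p) \<partial>M) = (\<integral>\<^sup>+x. indicator W x \<partial>M)"
    by (intro nn_integral_cong) (auto simp: indicator_def)
  then show ?thesis by simp
qed

lemma indicator_Lp_fun:
  "1 \<le> p \<Longrightarrow> (indicator W :: 'a \<Rightarrow> 'k::{real_normed_field, euclidean_space}) \<in> Lp_fun M p"
  using W_finite by (intro Lp_funI) (simp_all add: nn_integral_norm_indicator)

lemma Lp_norm_indicator_pos:
  assumes "1 \<le> p"
  shows "0 < Lp_norm M p (indicator W :: 'a \<Rightarrow> 'k::{real_normed_field, euclidean_space})"
proof -
  have "ennreal (Lp_norm M p (indicator W :: 'a \<Rightarrow> 'k) powr p) = emeasure M W"
    using Lp_norm_powr_nn[OF assms indicator_Lp_fun[OF assms]] by (simp add: nn_integral_norm_indicator)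
  then have "Lp_norm M p (indicator W :: 'a \<Rightarrow> 'k) \<noteq> 0" using W_pos by auto
  then show ?thesis using Lp_norm_nonneg[of M p "indicator W :: 'a \<Rightarrow> 'k"] by linarith
qed

text \<open>If \<open>T\<^sup>m u\<close> is close to the indicator of \<open>W\<close> for all \<open>m \<in> E\<close>, then \<open>T\<^sup>n u\<close> has
  norm bounded below, relative to \<open>\<mu> (f\<^bsup>m-n\<^esup> W)\<close>, on every level \<open>m - n\<close> with \<open>m \<in> E\<close>. As these
  levels are disjoint, the measures are summable over the differences of \<open>E\<close>.\<close>

lemma finite_space_of_frequent_visits:
  fixes u :: "'a \<Rightarrow> 'k::{real_normed_field, euclidean_space}"
  assumes p: "1 \<le> p" and u: "u \<in> Lp_fun M p" and "0 < \<delta>"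
    and dens: "\<forall>\<^sub>F N in sequentially. \<delta> * real N \<le> card {n \<in> {1..N}.
      Lp_norm M p (\<lambda>x. u ((f ^^ n) x) - indicator W x) < Lp_norm M p (indicator W :: 'a \<Rightarrow> 'k) / 2}"
  shows "emeasure M (space M) < \<infinity>"
proof -
  let ?one = "indicator W :: 'a \<Rightarrow> 'k"
  define a where "a = Lp_norm M p ?one"
  define g where "g n x = u ((f ^^ n) x)" for n x
  define E where "E = {n. Lp_norm M p (\<lambda>x. g n x - ?one x) < a / 2}"
  have dens': "\<forall>\<^sub>F N in sequentially. \<delta> * real N \<le> card (E \<inter> {1..N})"
  proof -
    have "{n \<in> {1..N}. Lp_norm M p (\<lambda>x. u ((f ^^ n) x) - ?one x) < Lp_norm M p ?one / 2}
        = E \<inter> {1..N}" for N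
      by (auto simp: E_def g_def a_def)
    then show ?thesis using dens by simp
  qed
  have g: "g n \<in> Lp_fun M p" for n
    unfolding g_def using p u by (rule Lp_fun_funpow)
  then have [measurable]: "g n \<in> borel_measurable M" for n by (simp add: Lp_fun_def)
  have one: "?one \<in> Lp_fun M p" by (rule indicator_Lp_fun[OF p])
  have a: "0 < a" unfolding a_def by (rule Lp_norm_indicator_pos[OF p])
  have upper: "(\<integral>\<^sup>+x. ennreal (norm (g n x) powr p) \<partial>M) \<le> ennreal ((3 / 2 * a) powr p)" if "n \<in> E" for n
  proof -
    have "Lp_norm M p (g n) = Lp_norm M p (\<lambda>x. (g n x - ?one x) + ?one x)" by simp
    also have "\<dots> \<le> Lp_norm M p (\<lambda>x. g n x - ?one x) + a"
      unfolding a_def by (intro Minkowski_inequality[OF p] Lp_fun_diff[OF p] g one)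
    also have "\<dots> \<le> 3 / 2 * a" using that by (simp add: E_def)
    finally show ?thesis
      unfolding Lp_norm_powr_nn[OF p g, symmetric] using p by (intro ennreal_leI powr_mono2) auto
  qed
  \<comment> \<open>Here \<open>v\<close> is \<open>g n\<close> cut down to W. Since
    \<open>?one\<close> and \<open>v\<close> vanish off W, their difference is dominated by that of
    \<open>g n\<close> and \<open>?one\<close>, so the norm of \<open>v\<close> is at least a - a /
    2.\<close>
  have lower: "ennreal ((a / 2) powr p) \<le> (\<integral>\<^sup>+x. ennreal (norm (g n x) powr p) * indicator W x \<partial>M)"
    if "n \<in> E" for n
  proof -
    define v where "v x = ?one x * g n x" for x
    have nv: "ennreal (norm (v x) powr p) = ennreal (norm (g n x) powr p) * indicator W x" for x
      by (simp add: v_def indicator_def)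
    have v: "v \<in> Lp_fun M p"
    proof (rule Lp_funI)
      have "(\<integral>\<^sup>+x. ennreal (norm (v x) powr p) \<partial>M) \<le> (\<integral>\<^sup>+x. ennreal (norm (g n x) powr p) \<partial>M)"
        unfolding nv by (intro nn_integral_mono) (auto simp: indicator_def)
      also have "\<dots> < \<infinity>" using upper[OF that] by (rule le_less_trans) simp
      finally show "(\<integral>\<^sup>+x. ennreal (norm (v x) powr p) \<partial>M) < \<infinity>" .
    qed (simp add: v_def[abs_def])
    have "a = Lp_norm M p (\<lambda>x. (?one x - v x) + v x)" by (simp add: a_def)
    also have "\<dots> \<le> Lp_norm M p (\<lambda>x. ?one x - v x) + Lp_norm M p v"
      by (intro Minkowski_inequality[OF p] Lp_fun_diff[OF p] v one)
    also have "Lp_norm M p (\<lambda>x. ?one x - v x) \<le> Lp_norm M p (\<lambda>x. g n x - ?one x)"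
      by (intro Lp_norm_mono[OF p] Lp_fun_diff[OF p] v one g)
        (auto simp: v_def indicator_def norm_minus_commute)
    also have "\<dots> < a / 2" using that by (simp add: E_def)
    finally have "a / 2 \<le> Lp_norm M p v" by simp
    then have "ennreal ((a / 2) powr p) \<le> ennreal (Lp_norm M p v powr p)"
      using p a by (intro ennreal_leI powr_mono2) auto
    also have "\<dots> = (\<integral>\<^sup>+x. ennreal (norm (g n x) powr p) * indicator W x \<partial>M)"
      unfolding Lp_norm_powr_nn[OF p v] nv ..
    finally show ?thesis .
  qed
  \<comment> \<open>The upper bound on the whole space divided by the lower bound on W, times the
    distortion factor. It does not depend on n.\<close>
  define R where "R = ennreal K * emeasure M W * ennreal ((3 / 2 * a) powr p) / ennreal ((a / 2) powr p)"
  have R: "R < \<infinity>"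
    unfolding R_def using W_finite a
    by (simp add: ennreal_divide_eq_top_iff less_top[symmetric] ennreal_mult_eq_top_iff)
  have diff_sums: "(\<Sum>m\<in>F. emeasure M (it (int m - int n) ` W)) \<le> R"
    if n: "n \<in> E" and F: "finite F" "F \<subseteq> E" for n F
  proof -
    have *: "emeasure M (it (int m - int n) ` W) * ennreal ((a / 2) powr p) \<le>
        ennreal K * emeasure M W *
          (\<integral>\<^sup>+x. ennreal (norm (g n x) powr p) * indicator (it (int m - int n) ` W) x \<partial>M)"
      if "m \<in> F" for m
    proof -
      \<comment> \<open>What time m shows on W, time n shows on level m - n. The integer iterate
        covers m < n as well.\<close>
      have eq: "g m x = g n (it (int m - int n) x)" if "x \<in> W" for x
      proof -
        have "(f ^^ n) (it (int m - int n) x) = (f ^^ m) x"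
          using it_add[of x "int n" "int m - int n"] that W_subset
          by (auto simp: it_of_nat[symmetric])
        then show ?thesis by (simp add: g_def)
      qed
      have "emeasure M (it (int m - int n) ` W) * ennreal ((a / 2) powr p) \<le>
          emeasure M (it (int m - int n) ` W) * (\<integral>\<^sup>+x. ennreal (norm (g m x) powr p) * indicator W x \<partial>M)"
        using that F by (intro mult_left_mono lower) auto
      also have "(\<integral>\<^sup>+x. ennreal (norm (g m x) powr p) * indicator W x \<partial>M)
          = (\<integral>\<^sup>+x. ennreal (norm (g n (it (int m - int n) x)) powr p) * indicator W x \<partial>M)"
        by (intro nn_integral_cong) (auto simp: eq indicator_def)
      also have "emeasure M (it (int m - int n) ` W) * \<dots> \<le> ennreal K * emeasure M W *
          (\<integral>\<^sup>+x. ennreal (norm (g n x) powr p) * indicator (it (int m - int n) ` W) x \<partial>M)"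
        by (rule distortion_nn_integral[where h = "\<lambda>x. ennreal (norm (g n x) powr p)"]) simp
      finally show ?thesis .
    qed
    have "(\<Sum>m\<in>F. emeasure M (it (int m - int n) ` W)) * ennreal ((a / 2) powr p)
        = (\<Sum>m\<in>F. emeasure M (it (int m - int n) ` W) * ennreal ((a / 2) powr p))"
      by (rule sum_distrib_right)
    also have "\<dots> \<le> (\<Sum>m\<in>F. ennreal K * emeasure M W *
        (\<integral>\<^sup>+x. ennreal (norm (g n x) powr p) * indicator (it (int m - int n) ` W) x \<partial>M))"
      by (intro sum_mono *)
    also have "\<dots> = ennreal K * emeasure M W *
        (\<integral>\<^sup>+x. (\<Sum>m\<in>F. ennreal (norm (g n x) powr p) * indicator (it (int m - int n) ` W) x) \<partial>M)"
      by (simp add: sum_distrib_left nn_integral_sum)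
    also have "\<dots> \<le> ennreal K * emeasure M W * (\<integral>\<^sup>+x. ennreal (norm (g n x) powr p) \<partial>M)"
    proof (intro mult_left_mono nn_integral_mono)
      fix x assume x: "x \<in> space M"
      have "(\<Sum>m\<in>F. ennreal (norm (g n x) powr p) * indicator (it (int m - int n) ` W) x)
          = (\<Sum>m\<in>F. if int m = level x + int n then ennreal (norm (g n x) powr p) else 0)"
        using x by (intro sum.cong refl) (auto simp: indicator_def mem_it_image_W_iff)
      \<comment> \<open>As x lies on a single level, at most one m contributes; an equation for m
        itself makes this visible to the simplifier.\<close>
      also have "\<dots> = (\<Sum>m\<in>F. if m = nat (level x + int n) \<and> 0 \<le> level x + int n
          then ennreal (norm (g n x) powr p) else 0)"
        by (intro sum.cong refl) auto
      also have "\<dots> \<le> ennreal (norm (g n x) powr p)"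
        using F by (cases "0 \<le> level x + int n") simp_all
      finally show "(\<Sum>m\<in>F. ennreal (norm (g n x) powr p) * indicator (it (int m - int n) ` W) x)
          \<le> ennreal (norm (g n x) powr p)" .
    qed auto
    also have "\<dots> \<le> ennreal K * emeasure M W * ennreal ((3 / 2 * a) powr p)"
      by (intro mult_left_mono upper n) simp
    finally have "(\<Sum>m\<in>F. emeasure M (it (int m - int n) ` W)) * ennreal ((a / 2) powr p)
        / ennreal ((a / 2) powr p) \<le> R"
      unfolding R_def by (rule divide_right_mono_ennreal)
    then show ?thesis using a by (simp add: ennreal_mult_divide_eq)
  qed
  obtain c where "1 \<le> c"
    and c: "\<And>n. emeasure M (it n ` W) \<le> ennreal c * emeasure M (it (n + 1) ` W)"
    using emeasure_it_image_le W_sets by metis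
  \<comment> \<open>The combinatorial lemma needs real weights, but a level could have infinite
    measure so far. As E is infinite, some difference m - n lies above k; its level has measure at
    most R, and finiteness descends from there to level k.\<close>
  have level_finite: "emeasure M (it k ` W) < \<infinity>" for k
  proof -
    have inf: "infinite E"
    proof
      assume fin: "finite E"
      have "\<forall>\<^sub>F N in sequentially. \<delta> * real N \<le> real (card E)"
        using dens' by eventually_elim
          (meson fin card_mono inf_le1 of_nat_le_iff order_trans)
      then obtain N\<^sub>0 where N\<^sub>0: "\<And>N. N\<^sub>0 \<le> N \<Longrightarrow> \<delta> * real N \<le> real (card E)"
        unfolding eventually_sequentially by blast
      define N where "N = max N\<^sub>0 (nat \<lceil>real (card E) / \<delta>\<rceil> + 1)"
      have "real (card E) / \<delta> < real N" unfolding N_def by linarith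
      then show False using N\<^sub>0[of N] \<open>0 < \<delta>\<close> by (simp add: N_def field_simps)
    qed
    then obtain n where n: "n \<in> E" using infinite_imp_nonempty by blast
    obtain m where m: "m \<in> E" "nat \<bar>k\<bar> + n \<le> m"
      using inf unfolding infinite_nat_iff_unbounded_le by blast
    define j where "j = nat (int m - int n - k)"
    have j: "int m - int n = k + int j" using m(2) by (simp add: j_def)
    have "emeasure M (it (int m - int n) ` W) \<le> R"
      using diff_sums[OF n, of "{m}"] m(1) by simp
    then have "emeasure M (it (k + int j) ` W) < \<infinity>"
      unfolding j using R by (rule le_less_trans)
    then show ?thesis
    proof (induction j)
      case (Suc j)
      have "emeasure M (it (k + int j) ` W) \<le> ennreal c * emeasure M (it (k + int (Suc j)) ` W)"
        using c[of "k + int j"] by (simp add: algebra_simps)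
      also have "\<dots> < \<infinity>" using Suc.prems by (simp add: ennreal_mult_less_top)
      finally show ?case by (rule Suc.IH)
    qed simp
  qed
  define w where "w k = measure M (it k ` W)" for k
  have w: "emeasure M (it k ` W) = ennreal (w k)" for k
    using level_finite[of k] by (simp add: w_def emeasure_eq_ennreal_measure)
  have "\<exists>D. \<forall>F. finite F \<longrightarrow> sum w F \<le> D"
  proof (rule bounded_sums_of_sums_over_differences[OF \<open>0 < \<delta>\<close> dens'])
    show "0 \<le> w k" for k by (simp add: w_def)
    show "w k \<le> c * w (k + 1)" for k
      using c[of k] \<open>1 \<le> c\<close> by (simp add: w ennreal_mult[symmetric] w_def ennreal_le_iff)
    show "(\<Sum>m\<in>F. w (int m - int n)) \<le> enn2real R" if "n \<in> E" "finite F" "F \<subseteq> E" for n F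
    proof -
      have "ennreal (\<Sum>m\<in>F. w (int m - int n)) \<le> R"
        using diff_sums[OF that] by (simp add: w sum_ennreal w_def)
      then have "enn2real (ennreal (\<Sum>m\<in>F. w (int m - int n))) \<le> enn2real R"
        using R by (intro enn2real_mono) auto
      then show ?thesis by (simp add: w_def sum_nonneg)
    qed
  qed fact
  then obtain D where D: "\<And>F. finite F \<Longrightarrow> sum w F \<le> D" by blast
  show ?thesis
  proof (rule finite_space_of_bounded_sums[of "ennreal D"])
    fix F :: "int set" assume "finite F"
    then show "(\<Sum>n\<in>F. emeasure M (it n ` W)) \<le> ennreal D"
      using D[of F] by (simp add: w sum_ennreal w_def ennreal_leI)
  qed simp
qed

section \<open>Approximation by bounded functions on finitely many levels\<close>

definition tame :: "nat \<Rightarrow> ('a \<Rightarrow> 'k::{real_normed_field, euclidean_space}) \<Rightarrow> bool" where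
  "tame m t \<longleftrightarrow> t \<in> borel_measurable M \<and>
     (\<forall>x\<in>space M. norm (t x) \<le> real m \<and> (int m < \<bar>level x\<bar> \<longrightarrow> t x = 0))"

text \<open>Truncates values and levels at the same m. At every point the truncation eventually
  equals u, and the error is dominated by \<open>norm (u x) powr p\<close>.\<close>

lemma tame_approximation:
  fixes u :: "'a \<Rightarrow> 'k::{real_normed_field, euclidean_space}"
  assumes p: "1 \<le> p" and u: "u \<in> Lp_fun M p" and e: "0 < e"
  obtains m t where "tame m t" "t \<in> Lp_fun M p" "Lp_norm M p (\<lambda>x. u x - t x) < e"
proof -
  have [measurable]: "u \<in> borel_measurable M" using u by (simp add: Lp_fun_def)
  \<comment> \<open>\<open>Suc m\<close> because a tail includes its boundary level, while a tame
    function may live on levels of absolute value exactly m.\<close>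
  define A where "A m = {x \<in> space M. norm (u x) \<le> real m} - tail (Suc m)" for m
  have A [measurable]: "A m \<in> sets M" for m unfolding A_def by simp
  define t where "t m x = indicator (A m) x * u x" for m x
  have t_meas [measurable]: "t m \<in> borel_measurable M" for m
    unfolding t_def[abs_def] by measurable
  have tame: "tame m (t m)" for m
    by (auto simp: tame_def t_def A_def indicator_def tail_def)
  have t: "t m \<in> Lp_fun M p" for m
  proof (rule Lp_funI)
    have "(\<integral>\<^sup>+x. ennreal (norm (t m x) powr p) \<partial>M) \<le> (\<integral>\<^sup>+x. ennreal (norm (u x) powr p) \<partial>M)"
      by (intro nn_integral_mono) (auto simp: t_def indicator_def)
    also have "\<dots> < \<infinity>" using Lp_norm_powr_nn[OF p u, symmetric] by simp
    finally show "(\<integral>\<^sup>+x. ennreal (norm (t m x) powr p) \<partial>M) < \<infinity>" .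
  qed simp
  have "(\<lambda>m. LINT x|M. norm (u x - t m x) powr p) \<longlonglongrightarrow> (LINT x|M. 0)"
  proof (rule integral_dominated_convergence[where w = "\<lambda>x. norm (u x) powr p"])
    show "integrable M (\<lambda>x. norm (u x) powr p)" using u by (simp add: Lp_fun_def)
    show "AE x in M. (\<lambda>m. norm (u x - t m x) powr p) \<longlonglongrightarrow> 0"
    proof (rule AE_I2)
      fix x assume x: "x \<in> space M"
      have "\<forall>\<^sub>F m in sequentially. norm (u x - t m x) powr p = 0"
        using eventually_ge_at_top[of "max (nat \<lceil>norm (u x)\<rceil>) (nat \<bar>level x\<bar>)"]
      proof eventually_elim
        case (elim m)
        then have "x \<in> A m" using x by (auto simp: A_def tail_def)
        then show ?case by (simp add: t_def)
      qed
      then show "(\<lambda>m. norm (u x - t m x) powr p) \<longlonglongrightarrow> 0" by (rule tendsto_eventually)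
    qed
    show "AE x in M. norm (norm (u x - t m x) powr p) \<le> norm (u x) powr p" for m
      by (auto simp: t_def indicator_def)
  qed auto
  then have "\<forall>\<^sub>F m in sequentially. (LINT x|M. norm (u x - t m x) powr p) < e powr p"
    using e by (intro order_tendstoD) auto
  then obtain m where "(LINT x|M. norm (u x - t m x) powr p) < e powr p"
    using eventually_happens' sequentially_bot by blast
  then have "Lp_norm M p (\<lambda>x. u x - t m x) powr p < e powr p" by (simp add: Lp_norm_powr[OF p])
  then have "Lp_norm M p (\<lambda>x. u x - t m x) < e"
    using powr_mono2[of p e "Lp_norm M p (\<lambda>x. u x - t m x)"] p e by force
  then show thesis using that tame t by blast
qed

end

section \<open>Periodic points and frequently hypercyclic vectors\<close>

context distorted_tower
begin

lemma bounded_in_Lp_fun: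
  fixes u :: "'a \<Rightarrow> 'k::{real_normed_field, euclidean_space}"
  assumes "1 \<le> p" and "emeasure M (space M) < \<infinity>" and "u \<in> borel_measurable M"
    and "\<And>x. x \<in> space M \<Longrightarrow> norm (u x) \<le> b"
  shows "u \<in> Lp_fun M p"
proof (rule Lp_funI)
  have "(\<integral>\<^sup>+x. ennreal (norm (u x) powr p) \<partial>M) \<le> (\<integral>\<^sup>+x. ennreal (b powr p) \<partial>M)"
    using assms by (intro nn_integral_mono ennreal_leI powr_mono2) auto
  also have "\<dots> < \<infinity>" using assms(2) by (simp add: ennreal_mult_less_top)
  finally show "(\<integral>\<^sup>+x. ennreal (norm (u x) powr p) \<partial>M) < \<infinity>" .
qed fact

lemma tame_Lp_fun:
  "1 \<le> p \<Longrightarrow> emeasure M (space M) < \<infinity> \<Longrightarrow> tame m t \<Longrightarrow> t \<in> Lp_fun M p"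
  by (rule bounded_in_Lp_fun[of _ _ "real m"]) (auto simp: tame_def)

lemma scaled_tail_tendsto_0:
  assumes "emeasure M (space M) < \<infinity>"
  shows "(\<lambda>q. ennreal b * emeasure M (tail q)) \<longlonglongrightarrow> 0"
proof -
  have "finite_measure M" using assms by (intro finite_measureI) auto
  from ennreal_tendsto_cmult[OF _ tail_tendsto_0[OF this refl], of "ennreal b"] show ?thesis by simp
qed

text \<open>The values of t on the levels from -m to m are repeated along each orbit with period N.
  The error comes from the other copies alone: it is bounded by m and lives on a tail of small
  measure.\<close>

lemma periodic_approximation:
  fixes t :: "'a \<Rightarrow> 'k::{real_normed_field, euclidean_space}"
  assumes p: "1 \<le> p" and fin: "emeasure M (space M) < \<infinity>" and t: "tame m t" and e: "0 < e"
  obtains \<psi> N where "0 < N" "\<psi> \<in> Lp_fun M p" "\<And>x. x \<in> space M \<Longrightarrow> \<psi> ((f ^^ N) x) = \<psi> x"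
    "Lp_norm M p (\<lambda>x. \<psi> x - t x) \<le> e"
proof -
  have [measurable]: "t \<in> borel_measurable M" and t_bound: "\<And>x. x \<in> space M \<Longrightarrow> norm (t x) \<le> m"
    and t_supp: "\<And>x. x \<in> space M \<Longrightarrow> t x \<noteq> 0 \<Longrightarrow> \<bar>level x\<bar> \<le> int m"
    using t by (auto simp: tame_def not_less[symmetric])
  have "\<forall>\<^sub>F q in sequentially. ennreal (real m powr p) * emeasure M (tail q) < ennreal (e powr p)"
    using scaled_tail_tendsto_0[OF fin] e by (intro order_tendstoD) auto
  then obtain q where q: "ennreal (real m powr p) * emeasure M (tail q) < ennreal (e powr p)"
    using eventually_happens' sequentially_bot by blast
  \<comment> \<open>The 2m + 1 levels of t plus a gap of q: the other copies start at absolute level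
    N - m, hence beyond q. In the next line, \<open>r l\<close> represents l modulo N in the window
    from -m to N - m - 1.\<close>
  define N where "N = 2 * m + 1 + q"
  define r where "r l = (l + int m) mod int N - int m" for l
  define \<psi> where "\<psi> x = t (it (r (level x) - level x) x)" for x
  have \<psi>_meas [measurable]: "\<psi> \<in> borel_measurable M"
    unfolding \<psi>_def[abs_def]
    by (rule measurable_compose_countable'[where f = "\<lambda>l x. t (it (r l - l) x)" and I = UNIV]) auto
  have \<psi>_bound: "norm (\<psi> x) \<le> m" if "x \<in> space M" for x
    unfolding \<psi>_def using that by (intro t_bound it_in_space)
  have \<psi>: "\<psi> \<in> Lp_fun M p"
    using p fin \<psi>_meas \<psi>_bound by (rule bounded_in_Lp_fun)
  have per: "\<psi> ((f ^^ N) x) = \<psi> x" if x: "x \<in> space M" for x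
  proof -
    have "(level x + int N + int m) mod int N = (level x + int m) mod int N"
      by (metis add.assoc add.commute mod_add_self2)
    then have "r (level x + int N) = r (level x)" by (simp add: r_def)
    then have "\<psi> ((f ^^ N) x) = t (it (r (level x) - (level x + int N)) (it (int N) x))"
      using x by (simp add: \<psi>_def level_funpow it_of_nat)
    also have "\<dots> = \<psi> x"
      using x by (simp add: \<psi>_def it_add[symmetric])
    finally show ?thesis .
  qed
  have diff: "ennreal (norm (\<psi> x - t x) powr p) \<le> ennreal (real m powr p) * indicator (tail q) x"
    if x: "x \<in> space M" for x
  proof (cases "\<bar>level x\<bar> \<le> int m")
    case True
    then have "r (level x) = level x" by (simp add: r_def N_def)
    then show ?thesis by (simp add: \<psi>_def)
  next
    case False
    then have t0: "t x = 0" using t_supp x by blast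
    show ?thesis
    proof (cases "\<psi> x = 0")
      case False
      have "\<bar>level (it (r (level x) - level x) x)\<bar> \<le> int m"
        using False x by (intro t_supp it_in_space) (simp_all add: \<psi>_def)
      then have r: "(level x + int m) mod int N \<le> 2 * int m"
        using x by (simp add: level_it r_def)
      \<comment> \<open>Otherwise the level lies outside the window from -m to m but below q in
        absolute value. The residue of level + m is then level + m or level + m + N, and both exceed
        2m.\<close>
      have "int q \<le> \<bar>level x\<bar>"
      proof (rule ccontr)
        assume small: "\<not> int q \<le> \<bar>level x\<bar>"
        show False
        proof (cases "0 \<le> level x")
          case True
          then have "(level x + int m) mod int N = level x + int m"
            using small by (intro mod_pos_pos_trivial) (auto simp: N_def)
          then show False using r True \<open>\<not> \<bar>level x\<bar> \<le> int m\<close> by simp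
        next
          case neg: False
          have "(level x + int m) mod int N = (level x + int m + int N) mod int N" by simp
          also have "\<dots> = level x + int m + int N"
            using small neg \<open>\<not> \<bar>level x\<bar> \<le> int m\<close> by (intro mod_pos_pos_trivial) (auto simp: N_def)
          finally show False using r small neg by (simp add: N_def)
        qed
      qed
      then have "x \<in> tail q" using x by (simp add: tail_def)
      then show ?thesis using \<psi>_bound[OF x] p by (simp add: t0 ennreal_leI powr_mono2)
    qed (simp add: t0)
  qed
  have "Lp_norm M p (\<lambda>x. \<psi> x - t x) \<le> e"
  proof (rule Lp_norm_leI[OF p])
    show "(\<lambda>x. \<psi> x - t x) \<in> Lp_fun M p"
      using p \<psi> tame_Lp_fun[OF p fin t] by (rule Lp_fun_diff)
    have "(\<integral>\<^sup>+x. ennreal (norm (\<psi> x - t x) powr p) \<partial>M)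
        \<le> (\<integral>\<^sup>+x. ennreal (real m powr p) * indicator (tail q) x \<partial>M)"
      by (intro nn_integral_mono diff)
    also have "\<dots> = ennreal (real m powr p) * emeasure M (tail q)"
      by (rule nn_integral_cmult_indicator) simp
    finally show "(\<integral>\<^sup>+x. ennreal (norm (\<psi> x - t x) powr p) \<partial>M) \<le> ennreal (e powr p)"
      using q by simp
  qed (use e in simp)
  then show thesis using that[of N \<psi>] \<psi> per by (simp add: N_def)
qed

text \<open>For \<open>n \<in> A j\<close> the function \<open>\<phi>\<close> is a translate of \<open>t j\<close> on the levels within distance \<open>m j\<close> of
  \<open>n\<close>. A copy of \<open>t j'\<close> is seen from the other times \<open>n\<close> only on levels of absolute value at least
  \<open>q j'\<close>, so the integrable function \<open>G\<close> dominates all of them at once, even though the bounds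
  \<open>m j'\<close> are unbounded in \<open>j'\<close>.\<close>

lemma frequently_visiting_function:
  fixes t :: "nat \<Rightarrow> 'a \<Rightarrow> 'k::{real_normed_field, euclidean_space}"
  assumes p: "1 \<le> p" and fin: "emeasure M (space M) < \<infinity>" and t: "\<And>j. tame (m j) (t j)"
  obtains \<phi> and A :: "nat \<Rightarrow> nat set" where "\<phi> \<in> Lp_fun M p"
    "\<And>j. \<exists>\<delta>>0. \<forall>\<^sub>F n in sequentially. \<delta> * real n \<le> card (A j \<inter> {1..n})"
    "\<And>j n. n \<in> A j \<Longrightarrow> Lp_norm M p (\<lambda>x. \<phi> ((f ^^ n) x) - t j x) \<le> 1 / real (Suc j)"
proof -
  have [measurable]: "t j \<in> borel_measurable M"
    and t_bound: "\<And>x. x \<in> space M \<Longrightarrow> norm (t j x) \<le> m j"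
    and t_supp: "\<And>x. x \<in> space M \<Longrightarrow> int (m j) < \<bar>level x\<bar> \<Longrightarrow> t j x = 0" for j
    using t[of j] by (auto simp: tame_def)
  \<comment> \<open>Beyond level \<open>q j\<close>, values of size \<open>m j\<close> cost less
    than 2^-j, which makes the sum \<open>G\<close> integrable.\<close>
  have "\<exists>q. ennreal (m j powr p) * emeasure M (tail q) < ennreal ((1 / 2) ^ j)" for j
    using order_tendstoD(2)[OF scaled_tail_tendsto_0[OF fin], of "ennreal ((1 / 2) ^ j)"]
      eventually_happens' sequentially_bot by fastforce
  then obtain q where q: "\<And>j. ennreal (m j powr p) * emeasure M (tail (q j)) < ennreal ((1 / 2) ^ j)"
    by metis
  define G where "G x = (\<Sum>j. ennreal (m j powr p) * indicator (tail (q j)) x)" for x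
  have [measurable]: "G \<in> borel_measurable M" unfolding G_def[abs_def] by measurable
  have G_ge: "ennreal (m j powr p) \<le> G x" if "x \<in> tail (q j)" for j x
    using sum_le_suminf[of "\<lambda>j. ennreal (m j powr p) * indicator (tail (q j)) x" "{j}"] that
    by (simp add: G_def summableI)
  have G_int: "(\<integral>\<^sup>+x. G x \<partial>M) < \<infinity>"
  proof -
    have "(\<integral>\<^sup>+x. G x \<partial>M) = (\<Sum>j. ennreal (m j powr p) * emeasure M (tail (q j)))"
      unfolding G_def by (subst nn_integral_suminf) (auto simp: nn_integral_cmult_indicator)
    also have "\<dots> \<le> (\<Sum>j. ennreal ((1 / 2) ^ j))"
      using q by (intro suminf_le less_imp_le summableI) auto
    also have "\<dots> = ennreal (\<Sum>j. (1 / 2) ^ j)"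
      by (intro suminf_ennreal2 summable_geometric) auto
    also have "\<dots> < \<infinity>" by simp
    finally show ?thesis .
  qed
  define \<nu> where "\<nu> = density M G"
  have \<nu>: "finite_measure \<nu>" "sets \<nu> = sets M"
    using G_int by (auto simp: \<nu>_def emeasure_density cong: nn_integral_cong intro!: finite_measureI)
  \<comment> \<open>The first condition keeps copies disjoint and pushes foreign ones out: if
    centres differ by N j + N j' or more, a copy of radius m j' appears at absolute level N j + q j'
    or beyond. The second bounds the error dominated by \<open>G\<close> on that tail.\<close>
  have "\<exists>N. m j + q j < N \<and> emeasure \<nu> (tail N) < ennreal ((1 / real (Suc j)) powr p)" for j
  proof -
    have "\<forall>\<^sub>F N in sequentially. m j + q j < N \<and> emeasure \<nu> (tail N) < ennreal ((1 / real (Suc j)) powr p)"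
      using tail_tendsto_0[OF \<nu>] by (intro eventually_conj eventually_gt_at_top order_tendstoD) auto
    then show ?thesis using eventually_happens' sequentially_bot by blast
  qed
  then obtain N where N: "\<And>j. m j + q j < N j"
    "\<And>j. emeasure \<nu> (tail (N j)) < ennreal ((1 / real (Suc j)) powr p)"
    by metis
  show thesis
  proof (rule separated_positive_density[of N])
    fix A :: "nat \<Rightarrow> nat set"
    assume A_gt: "\<And>j n. n \<in> A j \<Longrightarrow> N j < n"
      and A_sep: "\<And>j j' n n'. n \<in> A j \<Longrightarrow> n' \<in> A j' \<Longrightarrow> n < n' \<Longrightarrow> n + N j + N j' \<le> n'"
      and A_disj: "\<And>j j'. j \<noteq> j' \<Longrightarrow> A j \<inter> A j' = {}"
      and A_dens: "\<And>j. \<exists>\<delta>>0. \<forall>\<^sub>F n in sequentially. \<delta> * real n \<le> card (A j \<inter> {1..n})"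
    define near where "near l jn \<longleftrightarrow> snd jn \<in> A (fst jn) \<and> \<bar>l - int (snd jn)\<bar> \<le> int (m (fst jn))"
      for l :: int and jn
    have sep: "int (N j) + int (N j') \<le> \<bar>int n - int n'\<bar>"
      if "n \<in> A j" "n' \<in> A j'" "(j, n) \<noteq> (j', n')" for j j' n n'
    proof -
      have "n \<noteq> n'" using A_disj[of j j'] that by auto
      then show ?thesis
        using A_sep[OF that(1,2)] A_sep[OF that(2,1)] by (cases "n < n'") auto
    qed
    have near_unique: "jn = jn'" if near: "near l jn" "near l jn'" for l jn jn'
    proof (rule ccontr)
      assume "jn \<noteq> jn'"
      then have *: "int (N (fst jn)) + int (N (fst jn')) \<le> \<bar>int (snd jn) - int (snd jn')\<bar>"
        using near by (intro sep) (auto simp: near_def)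
      then show False using near N(1)[of "fst jn"] N(1)[of "fst jn'"] by (simp add: near_def) arith
    qed
    define sel where "sel l = (SOME jn. near l jn)" for l
    \<comment> \<open>One function for each fixed level: the choice in \<open>sel\<close> depends on
      the level only, so measurability reduces to countably many measurable pieces. Levels without a
      nearby copy get the value 0.\<close>
    define h where "h l x =
      (if \<exists>jn. near l jn then t (fst (sel l)) (it (- int (snd (sel l))) x) else 0)" for l x
    define \<phi> where "\<phi> x = h (level x) x" for x
    have [measurable]: "h l \<in> borel_measurable M" for l
      unfolding h_def[abs_def] by measurable
    have \<phi>_meas [measurable]: "\<phi> \<in> borel_measurable M"
      unfolding \<phi>_def[abs_def]
      by (rule measurable_compose_countable'[where I = UNIV]) auto
    have \<phi>_near: "\<phi> x = t j (it (- int n) x)" if "near (level x) (j, n)" for x j n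
    proof -
      have "sel (level x) = (j, n)"
        unfolding sel_def using that near_unique by (intro some_equality) auto
      then show ?thesis using that by (auto simp: \<phi>_def h_def)
    qed
    have \<phi>_nonzero: "\<exists>j n. near (level x) (j, n) \<and> norm (\<phi> x) \<le> m j"
      if x: "x \<in> space M" and "\<phi> x \<noteq> 0" for x
    proof -
      obtain j n where near: "near (level x) (j, n)"
        using \<open>\<phi> x \<noteq> 0\<close> by (auto simp: \<phi>_def h_def split: if_splits)
      then have "norm (\<phi> x) \<le> m j"
        unfolding \<phi>_near[OF near] using x by (intro t_bound it_in_space)
      then show ?thesis using near by blast
    qed
    have le_G: "ennreal (norm y powr p) \<le> G x" if "norm y \<le> m j" "x \<in> tail (q j)" for y :: 'k and x j
    proof -
      have "ennreal (norm y powr p) \<le> ennreal (m j powr p)"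
        using that(1) p by (intro ennreal_leI powr_mono2) auto
      then show ?thesis using G_ge[OF that(2)] by (rule order_trans)
    qed
    have \<phi>: "\<phi> \<in> Lp_fun M p"
    proof (rule Lp_funI)
      have "ennreal (norm (\<phi> x) powr p) \<le> G x" if x: "x \<in> space M" for x
      proof (cases "\<phi> x = 0")
        case False
        then obtain j n where near: "near (level x) (j, n)" and le: "norm (\<phi> x) \<le> m j"
          using \<phi>_nonzero x by blast
        \<comment> \<open>The centre n exceeds N j, hence m j + q j, so the whole copy lies beyond
          level \<open>q j\<close>.\<close>
        have "int (q j) \<le> \<bar>level x\<bar>"
          using near N(1)[of j] A_gt[of n j] by (simp add: near_def) arith
        then show ?thesis using le x by (intro le_G[of _ j]) (auto simp: tail_def)
      qed simp
      then have "(\<integral>\<^sup>+x. ennreal (norm (\<phi> x) powr p) \<partial>M) \<le> (\<integral>\<^sup>+x. G x \<partial>M)"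
        by (rule nn_integral_mono)
      then show "(\<integral>\<^sup>+x. ennreal (norm (\<phi> x) powr p) \<partial>M) < \<infinity>"
        using G_int by (rule le_less_trans)
    qed simp
    have close: "Lp_norm M p (\<lambda>x. \<phi> ((f ^^ n) x) - t j x) \<le> 1 / real (Suc j)" if n: "n \<in> A j" for j n
    proof (rule Lp_norm_leI[OF p])
      show "(\<lambda>x. \<phi> ((f ^^ n) x) - t j x) \<in> Lp_fun M p"
        using p Lp_fun_funpow[OF p \<phi>] tame_Lp_fun[OF p fin t] by (rule Lp_fun_diff)
      have "ennreal (norm (\<phi> ((f ^^ n) x) - t j x) powr p) \<le> G x * indicator (tail (N j)) x"
        if x: "x \<in> space M" for x
      proof (cases "\<bar>level x\<bar> \<le> int (m j)")
        case True
        then have "near (level ((f ^^ n) x)) (j, n)" using n x by (simp add: near_def level_funpow)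
        then have "\<phi> ((f ^^ n) x) = t j (it (- int n) (it (int n) x))"
          by (simp add: \<phi>_near it_of_nat)
        then show ?thesis using x by (simp add: it_uminus_it)
      next
        case outside: False
        then have t0: "t j x = 0" using t_supp x by simp
        show ?thesis
        proof (cases "\<phi> ((f ^^ n) x) = 0")
          case False
          then obtain j' n' where near: "near (level x + int n) (j', n')"
            and le: "norm (\<phi> ((f ^^ n) x)) \<le> m j'"
            using \<phi>_nonzero[OF funpow_in_space[OF x] False] unfolding level_funpow[OF x] by blast
          have "(j, n) \<noteq> (j', n')" using near outside by (auto simp: near_def)
          then have "int (N j) + int (N j') \<le> \<bar>int n - int n'\<bar>"
            using n near by (intro sep) (auto simp: near_def)
          then have "int (N j) \<le> \<bar>level x\<bar>" "int (q j') \<le> \<bar>level x\<bar>"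
            using near N(1)[of j'] unfolding near_def by (simp_all, arith+)
          then show ?thesis using le x le_G[of "\<phi> ((f ^^ n) x)" j' x] by (simp add: t0 tail_def)
        qed (simp add: t0)
      qed
      then have "(\<integral>\<^sup>+x. ennreal (norm (\<phi> ((f ^^ n) x) - t j x) powr p) \<partial>M)
          \<le> (\<integral>\<^sup>+x. G x * indicator (tail (N j)) x \<partial>M)"
        by (rule nn_integral_mono)
      also have "\<dots> = emeasure \<nu> (tail (N j))" by (simp add: \<nu>_def emeasure_density)
      finally show "(\<integral>\<^sup>+x. ennreal (norm (\<phi> ((f ^^ n) x) - t j x) powr p) \<partial>M)
          \<le> ennreal ((1 / real (Suc j)) powr p)"
        using N(2)[of j] by (meson le_less_trans less_imp_le)
    qed simp
    show thesis using \<phi> A_dens close by (rule that)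
  qed
qed

end

section \<open>Balls and closures in L^p, late visits and transitivity\<close>

lemma openin_Lp_topology:
  assumes "1 \<le> p"
  shows "openin (Lp_topology M p) U \<longleftrightarrow> U \<subseteq> Lp_space M p \<and>
    (\<forall>x\<in>U. \<exists>r>0. \<forall>y\<in>Lp_space M p. Lp_dist M p x y < r \<longrightarrow> y \<in> U)"
proof -
  interpret L: Metric_space "Lp_space M p" "Lp_dist M p" by (rule Metric_space_Lp[OF assms])
  have eq: "L.mball x r \<subseteq> U \<longleftrightarrow> (\<forall>y\<in>Lp_space M p. Lp_dist M p x y < r \<longrightarrow> y \<in> U)"
    if "x \<in> Lp_space M p" for x r
    using that unfolding L.mball_def by blast
  show ?thesis
    unfolding Lp_topology_def L.openin_mtopology Ball_def[of U]
  proof (intro conj_cong refl arg_cong[where f = All] ext imp_cong)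
    fix x assume "U \<subseteq> Lp_space M p" "x \<in> U"
    then have "x \<in> Lp_space M p" by blast
    then show "(\<exists>r>0. L.mball x r \<subseteq> U)
        \<longleftrightarrow> (\<exists>r>0. \<forall>y\<in>Lp_space M p. Lp_dist M p x y < r \<longrightarrow> y \<in> U)"
      by (simp only: eq)
  qed
qed

lemma openin_Lp_ball:
  assumes "1 \<le> p" and "x \<in> Lp_space M p"
  shows "openin (Lp_topology M p) {y \<in> Lp_space M p. Lp_dist M p x y < r}"
proof -
  have "{y \<in> Lp_space M p. Lp_dist M p x y < r} = Metric_space.mball (Lp_space M p) (Lp_dist M p) x r"
    using assms(2) by (auto simp: Metric_space.in_mball[OF Metric_space_Lp[OF assms(1)]])
  then show ?thesis
    unfolding Lp_topology_def by (simp add: Metric_space.openin_mball[OF Metric_space_Lp[OF assms(1)]])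
qed

lemma Lp_closure_of:
  assumes "1 \<le> p"
  shows "x \<in> Lp_topology M p closure_of S \<longleftrightarrow>
    x \<in> Lp_space M p \<and> (\<forall>r>0. \<exists>y\<in>S. y \<in> Lp_space M p \<and> Lp_dist M p x y < r)"
  unfolding Lp_topology_def Metric_space.metric_closure_of[OF Metric_space_Lp[OF assms]]
  by (auto simp: Metric_space.in_mball[OF Metric_space_Lp[OF assms]])

text \<open>If the visits to an open set stopped after time b, there would be at most b of them and
  their density would be 0. So a visit to U is followed by a later visit to V, and the time between
  them is the required k.\<close>

lemma frequently_hypercyclic_imp_transitive:
  assumes "frequently_hypercyclic X T"
  shows "topologically_transitive X T"
  unfolding topologically_transitive_def
proof (intro allI impI, elim conjE)
  fix U V assume U: "openin X U" "U \<noteq> {}" and V: "openin X V" "V \<noteq> {}"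
  obtain \<phi> where *: "\<And>U. openin X U \<Longrightarrow> U \<noteq> {} \<Longrightarrow>
      0 < liminf (\<lambda>N. ereal (real (card {n \<in> {1..N}. (T ^^ n) \<phi> \<in> U}) / real N))"
    using assms unfolding frequently_hypercyclic_def by blast
  have later: "\<exists>n>b. (T ^^ n) \<phi> \<in> U" if "openin X U" "U \<noteq> {}" for U b
  proof (rule ccontr)
    assume none: "\<not> (\<exists>n>b. (T ^^ n) \<phi> \<in> U)"
    have "(\<lambda>N. ereal (real (card {n \<in> {1..N}. (T ^^ n) \<phi> \<in> U}) / real N)) \<longlonglongrightarrow> ereal 0"
      unfolding lim_ereal
    proof (rule tendsto_sandwich[where f = "\<lambda>_. 0"])
      show "\<forall>\<^sub>F N in sequentially. real (card {n \<in> {1..N}. (T ^^ n) \<phi> \<in> U}) / real N \<le> real b / real N"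
      proof (intro always_eventually allI divide_right_mono of_nat_mono)
        fix N
        have "card {n \<in> {1..N}. (T ^^ n) \<phi> \<in> U} \<le> card {1..b}"
          using none by (intro card_mono) (auto simp: not_less)
        then show "card {n \<in> {1..N}. (T ^^ n) \<phi> \<in> U} \<le> b" by simp
      qed simp
      show "(\<lambda>N. real b / real N) \<longlonglongrightarrow> 0" by (rule lim_const_over_n)
    qed auto
    then have "liminf (\<lambda>N. ereal (real (card {n \<in> {1..N}. (T ^^ n) \<phi> \<in> U}) / real N)) = 0"
      by (intro lim_imp_Liminf) (auto simp: zero_ereal_def)
    then show False using *[OF that] by simp
  qed
  obtain n where n: "(T ^^ n) \<phi> \<in> U" using later[OF U] by blast
  obtain k where k: "n < k" "(T ^^ k) \<phi> \<in> V" using later[OF V] by blast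
  have "(T ^^ (k - n)) ((T ^^ n) \<phi>) = (T ^^ k) \<phi>"
    using k(1) by (metis funpow_add comp_apply le_add_diff_inverse2 less_imp_le)
  then show "\<exists>k>0. (T ^^ k) ` U \<inter> V \<noteq> {}"
    using n k by (intro exI[of _ "k - n"]) auto
qed

section \<open>Frequent hypercyclicity and periodic points versus finite measure\<close>

context distorted_tower
begin

text \<open>The passage from functions to classes, shared by frequently hypercyclic vectors and
  periodic points.\<close>

lemma finite_space_of_frequent_returns:
  fixes \<Phi> :: "('a \<Rightarrow> 'k::{real_normed_field, euclidean_space}) set"
  assumes p: "1 \<le> p" and \<Phi>: "\<Phi> \<in> Lp_space M p" and "0 < \<delta>"
    and dens: "\<forall>\<^sub>F N in sequentially. \<delta> * real N \<le> card {n \<in> {1..N}.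
      Lp_dist M p (Lp_class M p (indicator W)) ((composition_operator M p f ^^ n) \<Phi>)
        < Lp_norm M p (indicator W :: 'a \<Rightarrow> 'k) / 2}"
  shows "emeasure M (space M) < \<infinity>"
proof -
  obtain u where u: "u \<in> Lp_fun M p" "\<Phi> = Lp_class M p u" using \<Phi> by (auto simp: Lp_space_def)
  have "Lp_dist M p (Lp_class M p (indicator W)) ((composition_operator M p f ^^ n) \<Phi>)
      = Lp_norm M p (\<lambda>x. u ((f ^^ n) x) - indicator W x)" for n
    unfolding u(2) composition_operator_funpow_class[OF p u(1)]
    by (subst Lp_dist_class[OF indicator_Lp_fun[OF p] Lp_fun_funpow[OF p u(1)]])
      (rule Lp_norm_minus_commute)
  then show ?thesis
    using finite_space_of_frequent_visits[OF p u(1) \<open>0 < \<delta>\<close>] dens by simp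
qed

lemma finite_space_of_frequently_hypercyclic:
  assumes p: "1 \<le> p"
    and fhc: "frequently_hypercyclic
      (Lp_topology M p :: ('a \<Rightarrow> 'k::{real_normed_field, euclidean_space}) set topology)
      (composition_operator M p f)"
  shows "emeasure M (space M) < \<infinity>"
proof -
  let ?T = "composition_operator M p f :: ('a \<Rightarrow> 'k) set \<Rightarrow> _"
  let ?one = "Lp_class M p (indicator W :: 'a \<Rightarrow> 'k)"
  define U where "U = {y \<in> Lp_space M p. Lp_dist M p ?one y < Lp_norm M p (indicator W :: 'a \<Rightarrow> 'k) / 2}"
  have one: "?one \<in> Lp_space M p" by (intro Lp_class_in_space indicator_Lp_fun p)
  have "openin (Lp_topology M p) U" unfolding U_def by (rule openin_Lp_ball[OF p one])
  moreover have "?one \<in> U"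
    unfolding U_def using one Lp_norm_indicator_pos[OF p, where 'k = 'k]
      Metric_space.zero[OF Metric_space_Lp[OF p] one one] by simp
  ultimately obtain \<Phi> where \<Phi>: "\<Phi> \<in> Lp_space M p"
    and "0 < liminf (\<lambda>N. ereal (real (card {n \<in> {1..N}. (?T ^^ n) \<Phi> \<in> U}) / real N))"
    using fhc p unfolding frequently_hypercyclic_def by auto
  then obtain \<delta> where \<delta>: "0 < ereal \<delta>"
    "ereal \<delta> < liminf (\<lambda>N. ereal (real (card {n \<in> {1..N}. (?T ^^ n) \<Phi> \<in> U}) / real N))"
    using ereal_dense2 by blast
  show ?thesis
  proof (rule finite_space_of_frequent_returns[OF p \<Phi>])
    show "0 < \<delta>" using \<delta>(1) by simp
    show "\<forall>\<^sub>F N in sequentially. \<delta> * real N \<le> card {n \<in> {1..N}.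
      Lp_dist M p ?one ((?T ^^ n) \<Phi>) < Lp_norm M p (indicator W :: 'a \<Rightarrow> 'k) / 2}"
      using less_LiminfD[OF \<delta>(2)] eventually_gt_at_top[of 0]
    proof eventually_elim
      case (elim N)
      then have "\<delta> * real N \<le> card {n \<in> {1..N}. (?T ^^ n) \<Phi> \<in> U}" by (simp add: field_simps)
      also have "card {n \<in> {1..N}. (?T ^^ n) \<Phi> \<in> U} \<le> card {n \<in> {1..N}.
          Lp_dist M p ?one ((?T ^^ n) \<Phi>) < Lp_norm M p (indicator W :: 'a \<Rightarrow> 'k) / 2}"
        by (intro card_mono) (auto simp: U_def)
      finally show ?case by simp
    qed
  qed
qed

lemma finite_space_of_dense_periodic_points:
  assumes p: "1 \<le> p"
    and dense: "(Lp_topology M p :: ('a \<Rightarrow> 'k::{real_normed_field, euclidean_space}) set topology)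
      closure_of periodic_points (Lp_topology M p) (composition_operator M p f) = Lp_space M p"
  shows "emeasure M (space M) < \<infinity>"
proof -
  let ?T = "composition_operator M p f :: ('a \<Rightarrow> 'k) set \<Rightarrow> _"
  let ?one = "Lp_class M p (indicator W :: 'a \<Rightarrow> 'k)"
  let ?r = "Lp_norm M p (indicator W :: 'a \<Rightarrow> 'k) / 2"
  have "?one \<in> Lp_space M p" by (intro Lp_class_in_space indicator_Lp_fun p)
  then have "?one \<in> Lp_topology M p closure_of periodic_points (Lp_topology M p) ?T"
    using dense by simp
  moreover have "0 < ?r" using Lp_norm_indicator_pos[OF p, where 'k = 'k] by simp
  ultimately obtain \<Phi> where \<Phi>: "\<Phi> \<in> Lp_space M p" "\<Phi> \<in> periodic_points (Lp_topology M p) ?T"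
    "Lp_dist M p ?one \<Phi> < ?r"
    unfolding Lp_closure_of[OF p] by blast
  then obtain k where k: "0 < k" "(?T ^^ k) \<Phi> = \<Phi>" by (auto simp: periodic_points_def)
  have per: "(?T ^^ (k * i)) \<Phi> = \<Phi>" for i
    by (induction i) (simp_all add: funpow_add k(2))
  show ?thesis
  proof (rule finite_space_of_frequent_returns[OF p \<Phi>(1)])
    \<comment> \<open>A periodic point returns at all multiples of its period k, with density 1 / k;
      the factor 2 absorbs the rounding in \<open>N div k\<close> for N at least k.\<close>
    show "0 < 1 / real (2 * k)" using k(1) by simp
    show "\<forall>\<^sub>F N in sequentially. 1 / real (2 * k) * real N
      \<le> card {n \<in> {1..N}. Lp_dist M p ?one ((?T ^^ n) \<Phi>) < ?r}"
      using eventually_ge_at_top[of k]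
    proof eventually_elim
      case (elim N)
      have "(\<lambda>i. k * i) ` {1..N div k} \<subseteq> {n \<in> {1..N}. Lp_dist M p ?one ((?T ^^ n) \<Phi>) < ?r}"
      proof safe
        fix i assume i: "i \<in> {1..N div k}"
        then have "k * i \<le> N"
          using k(1) by (simp add: less_eq_div_iff_mult_less_eq mult.commute)
        then show "k * i \<in> {1..N}" using i k(1) by simp
        show "Lp_dist M p ?one ((?T ^^ (k * i)) \<Phi>) < ?r" using \<Phi>(3) by (simp only: per)
      qed
      then have "N div k \<le> card {n \<in> {1..N}. Lp_dist M p ?one ((?T ^^ n) \<Phi>) < ?r}"
        using card_inj_on_le[of "\<lambda>i. k * i" "{1..N div k}"] k(1) by (simp add: inj_on_def)
      moreover have "1 / real (2 * k) * real N \<le> real (N div k)"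
      proof -
        have "1 \<le> N div k" using elim k(1) by (simp add: less_eq_div_iff_mult_less_eq)
        then have "k \<le> k * (N div k)" by simp
        moreover have "N < k * (N div k) + k" using dividend_less_times_div[OF k(1), of N] by simp
        moreover have "2 * k * (N div k) = k * (N div k) + k * (N div k)" by simp
        ultimately have "N \<le> 2 * k * (N div k)" by linarith
        then have "real N \<le> real (2 * k) * real (N div k)" by (metis of_nat_le_iff of_nat_mult)
        then show ?thesis using k(1) by (simp add: field_simps)
      qed
      ultimately show ?case by (meson of_nat_mono order_trans)
    qed
  qed
qed

lemma dense_periodic_points_of_finite_space:
  assumes p: "1 \<le> p" and fin: "emeasure M (space M) < \<infinity>"
  shows "(Lp_topology M p :: ('a \<Rightarrow> 'k::{real_normed_field, euclidean_space}) set topology)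
      closure_of periodic_points (Lp_topology M p) (composition_operator M p f) = Lp_space M p"
proof (intro equalityI subsetI)
  let ?T = "composition_operator M p f :: ('a \<Rightarrow> 'k) set \<Rightarrow> _"
  fix \<Phi> :: "('a \<Rightarrow> 'k) set" assume "\<Phi> \<in> Lp_space M p"
  then obtain u where u: "u \<in> Lp_fun M p" "\<Phi> = Lp_class M p u" by (auto simp: Lp_space_def)
  have "\<exists>y\<in>periodic_points (Lp_topology M p) ?T. y \<in> Lp_space M p \<and> Lp_dist M p \<Phi> y < r" if "0 < r" for r
  proof -
    have "0 < r / 2" using that by simp
    then obtain m t where t: "tame m t" "t \<in> Lp_fun M p" "Lp_norm M p (\<lambda>x. u x - t x) < r / 2"
      using tame_approximation[OF p u(1)] by metis
    obtain \<psi> N where N: "0 < N" and \<psi>: "\<psi> \<in> Lp_fun M p" "\<And>x. x \<in> space M \<Longrightarrow> \<psi> ((f ^^ N) x) = \<psi> x"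
      "Lp_norm M p (\<lambda>x. \<psi> x - t x) \<le> r / 2"
      using periodic_approximation[OF p fin t(1) \<open>0 < r / 2\<close>] by metis
    have "(?T ^^ N) (Lp_class M p \<psi>) = Lp_class M p \<psi>"
      unfolding composition_operator_funpow_class[OF p \<psi>(1)]
      using \<psi>(2) by (subst Lp_class_eq_iff) (auto intro: Lp_fun_funpow p \<psi>(1))
    then have "Lp_class M p \<psi> \<in> periodic_points (Lp_topology M p) ?T"
      using N \<psi>(1) p by (auto simp: periodic_points_def Lp_class_in_space)
    moreover have "Lp_dist M p \<Phi> (Lp_class M p \<psi>) < r"
    proof -
      have "Lp_dist M p \<Phi> (Lp_class M p \<psi>)
          \<le> Lp_dist M p \<Phi> (Lp_class M p t) + Lp_dist M p (Lp_class M p t) (Lp_class M p \<psi>)"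
        using u t(2) \<psi>(1)
        by (intro Metric_space.triangle[OF Metric_space_Lp[OF p]]) (auto intro: Lp_class_in_space)
      also have "\<dots> = Lp_norm M p (\<lambda>x. u x - t x) + Lp_norm M p (\<lambda>x. \<psi> x - t x)"
        using u t(2) \<psi>(1) by (simp add: Lp_dist_class Lp_norm_minus_commute[of M p t \<psi>])
      finally show ?thesis using t(3) \<psi>(3) by linarith
    qed
    ultimately show ?thesis using \<psi>(1) Lp_class_in_space by blast
  qed
  then show "\<Phi> \<in> Lp_topology M p closure_of periodic_points (Lp_topology M p) ?T"
    using \<open>\<Phi> \<in> Lp_space M p\<close> by (simp add: Lp_closure_of[OF p])
qed (simp add: Lp_closure_of[OF p])

lemma frequently_hypercyclic_of_finite_space:
  assumes p: "1 \<le> p" and fin: "emeasure M (space M) < \<infinity>"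
    and sep: "separable_space
      (Lp_topology M p :: ('a \<Rightarrow> 'k::{real_normed_field, euclidean_space}) set topology)"
  shows "frequently_hypercyclic (Lp_topology M p :: ('a \<Rightarrow> 'k) set topology) (composition_operator M p f)"
proof -
  let ?T = "composition_operator M p f :: ('a \<Rightarrow> 'k) set \<Rightarrow> _"
  obtain D :: "('a \<Rightarrow> 'k) set set" where D: "countable D" "D \<subseteq> Lp_space M p"
    and D_dense: "Lp_topology M p closure_of D = Lp_space M p"
    using sep p by (auto simp: separable_space_def)
  have "Lp_class M p (indicator W :: 'a \<Rightarrow> 'k) \<in> Lp_space M p"
    by (intro Lp_class_in_space indicator_Lp_fun p)
  then have "D \<noteq> {}" using D_dense by auto
  text \<open>Every element of \<open>D\<close> occurs infinitely often in this enumeration.\<close>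
  define d where "d j = from_nat_into D (fst (prod_decode j))" for j
  have d: "d j \<in> Lp_space M p" for j
    using D(2) from_nat_into[OF \<open>D \<noteq> {}\<close>] by (auto simp: d_def)
  have "\<exists>m t. tame m t \<and> t \<in> Lp_fun M p \<and> Lp_norm M p (\<lambda>x. Lp_rep (d j) x - t x) < 1 / real (Suc j)" for j
    using tame_approximation[OF p Lp_rep_in(1)[OF d], of "1 / real (Suc j)"]
    by (metis of_nat_0_less_iff zero_less_Suc zero_less_divide_1_iff)
  then obtain m t where t: "\<And>j. tame (m j) (t j)" "\<And>j. t j \<in> Lp_fun M p"
    and d_t: "\<And>j. Lp_norm M p (\<lambda>x. Lp_rep (d j) x - t j x) < 1 / real (Suc j)"
    by metis
  show ?thesis
  proof (rule frequently_visiting_function[OF p fin t(1)])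
    fix \<phi> and A :: "nat \<Rightarrow> nat set"
    assume \<phi>: "\<phi> \<in> Lp_fun M p"
      and A: "\<And>j. \<exists>\<delta>>0. \<forall>\<^sub>F n in sequentially. \<delta> * real n \<le> card (A j \<inter> {1..n})"
      and \<phi>_t: "\<And>j n. n \<in> A j \<Longrightarrow> Lp_norm M p (\<lambda>x. \<phi> ((f ^^ n) x) - t j x) \<le> 1 / real (Suc j)"
    have dist: "Lp_dist M p (d j) ((?T ^^ n) (Lp_class M p \<phi>)) < 2 / real (Suc j)" if "n \<in> A j" for j n
    proof -
      let ?g = "\<lambda>x. \<phi> ((f ^^ n) x)"
      have g: "?g \<in> Lp_fun M p" by (rule Lp_fun_funpow[OF p \<phi>])
      have dj: "d j = Lp_class M p (Lp_rep (d j))" by (simp add: Lp_rep_in(2)[OF d])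
      have "Lp_dist M p (d j) (Lp_class M p ?g)
          \<le> Lp_dist M p (d j) (Lp_class M p (t j)) + Lp_dist M p (Lp_class M p (t j)) (Lp_class M p ?g)"
        by (intro Metric_space.triangle[OF Metric_space_Lp[OF p]] d Lp_class_in_space t(2) g)
      also have "Lp_dist M p (d j) (Lp_class M p (t j)) = Lp_norm M p (\<lambda>x. Lp_rep (d j) x - t j x)"
        by (subst dj) (intro Lp_dist_class Lp_rep_in(1) d t(2))
      also have "Lp_dist M p (Lp_class M p (t j)) (Lp_class M p ?g) = Lp_norm M p (\<lambda>x. ?g x - t j x)"
        by (simp add: Lp_dist_class t(2) g Lp_norm_minus_commute[of M p "t j"])
      also have "Lp_norm M p (\<lambda>x. Lp_rep (d j) x - t j x) + \<dots> < 2 / real (Suc j)"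
        using d_t[of j] \<phi>_t[OF that] by simp
      finally show ?thesis by (simp add: composition_operator_funpow_class[OF p \<phi>])
    qed
    show ?thesis
      unfolding frequently_hypercyclic_def
    proof (intro bexI[of _ "Lp_class M p \<phi>"] allI impI, elim conjE)
      fix U :: "('a \<Rightarrow> 'k) set set" assume U: "openin (Lp_topology M p) U" "U \<noteq> {}"
      then have "U \<inter> Lp_topology M p closure_of D \<noteq> {}"
        using D_dense openin_subset[OF U(1)] p by auto
      then have "U \<inter> D \<noteq> {}" using openin_Int_closure_of_eq_empty[OF U(1)] by blast
      then obtain y r where y: "y \<in> U" "y \<in> D" "0 < r"
        and r: "\<And>z. z \<in> Lp_space M p \<Longrightarrow> Lp_dist M p y z < r \<Longrightarrow> z \<in> U"
        using U(1) unfolding openin_Lp_topology[OF p] by blast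
      obtain i where i: "y = from_nat_into D i"
        using from_nat_into_surj[OF D(1) y(2)] by metis
      obtain k where k: "2 / r < real k" using reals_Archimedean2 by blast
      \<comment> \<open>The accuracy 2 / (j + 1) suffices only for late indices. The first component
        i makes \<open>d j\<close> equal to y, and j is at least k > 2 / r.\<close>
      define j where "j = prod_encode (i, k)"
      have dj: "d j = y" by (simp add: d_def j_def i)
      have "k \<le> j" unfolding j_def by (rule le_prod_encode_2)
      then have "2 / r < real (Suc j)" using k by simp
      then have "2 / real (Suc j) < r" using y(3) by (simp add: field_simps)
      then have visits: "(?T ^^ n) (Lp_class M p \<phi>) \<in> U" if "n \<in> A j" for n
        using dist[OF that] unfolding dj composition_operator_funpow_class[OF p \<phi>]
        by (intro r Lp_class_in_space Lp_fun_funpow p \<phi>) simp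
      obtain \<delta> where \<delta>: "0 < \<delta>" "\<forall>\<^sub>F N in sequentially. \<delta> * real N \<le> card (A j \<inter> {1..N})"
        using A[of j] by blast
      have "\<forall>\<^sub>F N in sequentially. ereal \<delta> \<le>
          ereal (real (card {n \<in> {1..N}. (?T ^^ n) (Lp_class M p \<phi>) \<in> U}) / real N)"
        using \<delta>(2) eventually_gt_at_top[of 0]
      proof eventually_elim
        case (elim N)
        have "card (A j \<inter> {1..N}) \<le> card {n \<in> {1..N}. (?T ^^ n) (Lp_class M p \<phi>) \<in> U}"
          using visits by (intro card_mono) auto
        then show ?case using elim by (simp add: field_simps)
      qed
      then have "ereal \<delta> \<le> liminf (\<lambda>N.
          ereal (real (card {n \<in> {1..N}. (?T ^^ n) (Lp_class M p \<phi>) \<in> U}) / real N))"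
        by (rule Liminf_bounded)
      then show "0 < liminf (\<lambda>N. ereal (real (card {n \<in> {1..N}. (?T ^^ n) (Lp_class M p \<phi>) \<in> U}) / real N))"
        by (rule less_le_trans[of 0 "ereal \<delta>", rotated]) (simp add: \<delta>(1))
    qed (use p \<phi> Lp_class_in_space in simp)
  qed
qed

end

text \<open>The lower distortion inequality is multiplied out. Cancelling in \<open>ennreal\<close>
  requires denominators that are neither 0 nor infinite, so null sets C are treated apart; for them
  the left side is 0.\<close>

lemma distorted_tower_exists:
  assumes "bounded_distortion_system M f"
  obtains W K where "distorted_tower M f W K"
proof -
  interpret bounded_distortion_system M f by fact
  show thesis
    using bounded_distortion
  proof (elim exE conjE)
    fix W and K :: real
    assume W: "wandering M f W" "0 < emeasure M W" "emeasure M W < \<infinity>"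
      and "0 < K" and cover: "space M = (\<Union>n. it n ` W)"
      and dist: "\<forall>n. \<forall>C\<in>sets M. C \<subseteq> W \<and> 0 < emeasure M C \<longrightarrow>
        ennreal (1 / K) * (emeasure M (it n ` W) / emeasure M W) \<le> emeasure M (it n ` C) / emeasure M C \<and>
        emeasure M (it n ` C) / emeasure M C \<le> ennreal K * (emeasure M (it n ` W) / emeasure M W)"
    have "distorted_tower M f W K"
    proof unfold_locales
      show "W \<in> sets M" "disjoint_family (\<lambda>n. it n ` W)" using W(1) by (auto simp: wandering_def)
      show "emeasure M W < \<infinity>" "space M = (\<Union>n. it n ` W)" "0 < emeasure M W" by fact+
      fix n C assume C: "C \<in> sets M" "C \<subseteq> W"
      show "emeasure M (it n ` W) * emeasure M C \<le> ennreal K * emeasure M W * emeasure M (it n ` C)"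
      proof (cases "emeasure M C = 0")
        case False
        let ?a = "emeasure M W" and ?b = "emeasure M C" and ?w = "emeasure M (it n ` W)"
          and ?v = "emeasure M (it n ` C)"
        have fin: "?b \<noteq> top"
          using emeasure_mono[OF C(2), of M] W by (auto simp: wandering_def top_unique)
        have cancel: "x / y * y = x" if "y \<noteq> 0" "y \<noteq> top" for x y :: ennreal
          using that by (simp add: ennreal_divide_times ennreal_divide_self less_top)
        have "?w * ?b = (ennreal K * ennreal (1 / K)) * (?w / ?a * ?a) * ?b"
          using \<open>0 < K\<close> W by (simp add: cancel ennreal_mult[symmetric])
        also have "\<dots> = ennreal K * ?a * ?b * (ennreal (1 / K) * (?w / ?a))" by (simp only: ac_simps)
        also have "\<dots> \<le> ennreal K * ?a * ?b * (?v / ?b)"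
        proof (rule mult_left_mono)
          have "0 < ?b" using False by (simp add: zero_less_iff_neq_zero)
          then show "ennreal (1 / K) * (?w / ?a) \<le> ?v / ?b" using dist C by blast
        qed simp
        also have "\<dots> = ennreal K * ?a * (?v / ?b * ?b)" by (simp only: ac_simps)
        also have "\<dots> = ennreal K * ?a * ?v" using False fin by (simp add: cancel)
        finally show ?thesis .
      qed simp
    qed
    then show thesis by (rule that)
  qed
qed

theorem theorem3p7:
  fixes M :: "'a measure" and f :: "'a \<Rightarrow> 'a" and p :: real
  assumes "bounded_distortion_system M f"
    and "1 \<le> p"
    and "separable_space
      (Lp_topology M p :: ('a \<Rightarrow> 'k::{real_normed_field, euclidean_space}) set topology)"
  shows "(summability_condition M f \<longleftrightarrow>
       frequently_hypercyclic (Lp_topology M p :: ('a \<Rightarrow> 'k) set topology)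
         (composition_operator M p f)) \<and>
    (frequently_hypercyclic (Lp_topology M p :: ('a \<Rightarrow> 'k) set topology)
         (composition_operator M p f) \<longleftrightarrow>
       chaotic (Lp_topology M p :: ('a \<Rightarrow> 'k) set topology) (composition_operator M p f))"
proof -
  obtain W K where "distorted_tower M f W K" using distorted_tower_exists[OF assms(1)] .
  then interpret distorted_tower M f W K .
  let ?X = "Lp_topology M p :: ('a \<Rightarrow> 'k) set topology" and ?T = "composition_operator M p f"
  have fhc: "frequently_hypercyclic ?X ?T \<longleftrightarrow> emeasure M (space M) < \<infinity>"
    using finite_space_of_frequently_hypercyclic[OF assms(2)]
      frequently_hypercyclic_of_finite_space[OF assms(2) _ assms(3)] by blast
  \<comment> \<open>From finite measure, transitivity is obtained through frequent hypercyclicity,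
    so separability enters here as well.\<close>
  have "chaotic ?X ?T \<longleftrightarrow> emeasure M (space M) < \<infinity>"
    using finite_space_of_dense_periodic_points[OF assms(2), where 'k = 'k]
      dense_periodic_points_of_finite_space[OF assms(2), where 'k = 'k]
      frequently_hypercyclic_imp_transitive[of ?X ?T] fhc assms(2)
    by (auto simp: chaotic_def)
  then show ?thesis using fhc summability_iff_finite by simp
qed

end
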